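(* Let $(M,g)$ be a Lorentzian manifold admitting a metric connection $\nabla$ with $\nabla$-parallel twistor-free torsion whose vectorial component $\xi$ is non-vanishing. Then for each of the values $\eta=1$, $\eta=-1$, $\eta=0$, the manifold $(M,g)$ is not $\eta$-complete.
   Context: Lorentzian manifolds have signature $(-,+,\dots,+)$ (tangent spaces are identified with the Minkowski space $\mathbb{R}^{1,n+1}$, $\dim M=n+2\ge 2$). $\nabla^g$ denotes the Levi-Civita connection. A connection $\nabla$ on $(M,g)$ is metric if $\nabla g=0$. Bivectors act by $(X\wedge Y)Z=g(X,Z)Y-g(Y,Z)X$. For a 3-form $S$ write $g(S(X)Y,Z)=g(S(X,Y),Z)=S(X,Y,Z)$. A metric connection with twistor-free torsion (i.e. torsion with zero twistorial component) is a connection of the form $$\nabla_X=\nabla^g_X+X\wedge\xi+\tfrac12 S(X),$$ where $\xi\in\Gamma(TM)$ is the vectorial component and $S\in\Omega^3(M)$ is the skew-symmetric component of the torsion; its torsion is $T(X,Y)=(X\wedge Y)\xi+S(X,Y)$. The torsion is parallel if $\nabla T=0$, which is equivalent to $\nabla\xi=0$ and $\nabla S=0$. $(M,g)$ is called $\eta$-complete for $\eta=1,-1,0$ if it is, respectively, space-like, time-like, or light-like geodesically complete, i.e. all (maximal) $\nabla^g$-geodesics of the corresponding causal type are defined on the whole of $\mathbb{R}$. *)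

theory Defs
  imports "HOL-Analysis.Analysis"
begin

section \<open>Smooth maps and smooth manifolds\<close>

text \<open>Only used for open sets \<open>U\<close> in finite-dimensional domains.\<close>

primrec C_k_on :: "nat \<Rightarrow> 'a set \<Rightarrow> ('a::real_normed_vector \<Rightarrow> 'b::real_normed_vector) \<Rightarrow> bool" where
  "C_k_on 0 U f \<longleftrightarrow> continuous_on U f"
| "C_k_on (Suc k) U f \<longleftrightarrow> (\<forall>x\<in>U. f differentiable (at x)) \<and>
     (\<forall>v. C_k_on k U (\<lambda>x. frechet_derivative f (at x) v))"

definition smooth_on :: "'a set \<Rightarrow> ('a::real_normed_vector \<Rightarrow> 'b::real_normed_vector) \<Rightarrow> bool" where
  "smooth_on U f \<longleftrightarrow> (\<forall>k. C_k_on k U f)"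

text \<open>A manifold is a Hausdorff, second countable type \<open>'m\<close> with a smooth atlas modelled on
  \<open>'e\<close>. A chart is a pair of its domain and its coordinate map, whose values outside the domain
  are irrelevant.\<close>

type_synonym ('m, 'e) chart = "'m set \<times> ('m \<Rightarrow> 'e)"

definition chart_image :: "('m, 'e) chart \<Rightarrow> 'e set" where
  "chart_image c = snd c ` fst c"

definition overlap :: "('m, 'e) chart \<Rightarrow> ('m, 'e) chart \<Rightarrow> 'e set" where
  "overlap c d = snd c ` (fst c \<inter> fst d)"

definition transition :: "('m, 'e) chart \<Rightarrow> ('m, 'e) chart \<Rightarrow> 'e \<Rightarrow> 'e" where
  "transition c d = (\<lambda>x. snd d (inv_into (fst c) (snd c) x))"

definition jac :: "('m, 'e::euclidean_space) chart \<Rightarrow> ('m, 'e) chart \<Rightarrow> 'e \<Rightarrow> 'e \<Rightarrow> 'e" where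
  "jac c d x = frechet_derivative (transition c d) (at x)"

definition smooth_atlas ::
  "('m::{t2_space, second_countable_topology}, 'e::euclidean_space) chart set \<Rightarrow> bool" where
  "smooth_atlas A \<longleftrightarrow>
     (\<forall>c\<in>A. open (fst c) \<and> open (chart_image c) \<and>
        (\<exists>h. homeomorphism (fst c) (chart_image c) (snd c) h)) \<and>
     (\<Union>c\<in>A. fst c) = UNIV \<and>
     (\<forall>c\<in>A. \<forall>d\<in>A. smooth_on (overlap c d) (transition c d))"

section \<open>Fields on a manifold, by their local representatives\<close>

text \<open>A field assigns to every chart \<open>c\<close> its local representative, a function on
  \<open>chart_image c\<close>; representatives in different charts are related by the usual
  transformation law.\<close>

type_synonym ('m, 'e) vector_field = "('m, 'e) chart \<Rightarrow> 'e \<Rightarrow> 'e"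
type_synonym ('m, 'e) form2 = "('m, 'e) chart \<Rightarrow> 'e \<Rightarrow> 'e \<Rightarrow> 'e \<Rightarrow> real"
type_synonym ('m, 'e) form3 = "('m, 'e) chart \<Rightarrow> 'e \<Rightarrow> 'e \<Rightarrow> 'e \<Rightarrow> 'e \<Rightarrow> real"
type_synonym ('m, 'e) christoffel = "('m, 'e) chart \<Rightarrow> 'e \<Rightarrow> 'e \<Rightarrow> 'e \<Rightarrow> 'e"

definition smooth_vector_field ::
  "('m, 'e::euclidean_space) chart set \<Rightarrow> ('m, 'e) vector_field \<Rightarrow> bool" where
  "smooth_vector_field A X \<longleftrightarrow>
     (\<forall>c\<in>A. smooth_on (chart_image c) (X c)) \<and>
     (\<forall>c\<in>A. \<forall>d\<in>A. \<forall>x\<in>overlap c d. X d (transition c d x) = jac c d x (X c x))"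

definition three_form ::
  "('m, 'e::euclidean_space) chart set \<Rightarrow> ('m, 'e) form3 \<Rightarrow> bool" where
  "three_form A S \<longleftrightarrow>
     (\<forall>c\<in>A. \<forall>x\<in>chart_image c. \<forall>u v w.
        bilinear (S c x u) \<and> S c x v u w = - S c x u v w \<and> S c x u w v = - S c x u v w) \<and>
     (\<forall>c\<in>A. \<forall>u v w. smooth_on (chart_image c) (\<lambda>x. S c x u v w)) \<and>
     (\<forall>c\<in>A. \<forall>d\<in>A. \<forall>x\<in>overlap c d. \<forall>u v w.
        S d (transition c d x) (jac c d x u) (jac c d x v) (jac c d x w) = S c x u v w)"

definition lorentzian_form :: "('e::euclidean_space \<Rightarrow> 'e \<Rightarrow> real) \<Rightarrow> bool" where
  "lorentzian_form b \<longleftrightarrow> bilinear b \<and> (\<forall>u v. b u v = b v u) \<and>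
     (\<exists>E e0. independent E \<and> span E = UNIV \<and> e0 \<in> E \<and> b e0 e0 = -1 \<and>
        (\<forall>e\<in>E - {e0}. b e e = 1) \<and> (\<forall>e\<in>E. \<forall>f\<in>E. e \<noteq> f \<longrightarrow> b e f = 0))"

definition lorentzian_metric ::
  "('m, 'e::euclidean_space) chart set \<Rightarrow> ('m, 'e) form2 \<Rightarrow> bool" where
  "lorentzian_metric A g \<longleftrightarrow>
     (\<forall>c\<in>A. \<forall>x\<in>chart_image c. lorentzian_form (g c x)) \<and>
     (\<forall>c\<in>A. \<forall>u v. smooth_on (chart_image c) (\<lambda>x. g c x u v)) \<and>
     (\<forall>c\<in>A. \<forall>d\<in>A. \<forall>x\<in>overlap c d. \<forall>u v.
        g d (transition c d x) (jac c d x u) (jac c d x v) = g c x u v)"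

definition lorentzian_manifold ::
  "('m::{t2_space, second_countable_topology}, 'e::euclidean_space) chart set
     \<Rightarrow> ('m, 'e) form2 \<Rightarrow> bool" where
  "lorentzian_manifold A g \<longleftrightarrow> DIM('e) \<ge> 2 \<and> smooth_atlas A \<and> lorentzian_metric A g"

section \<open>Connections\<close>

text \<open>A connection is given by its Christoffel maps \<open>D c x\<close>: in the chart \<open>c\<close>, the local
  representative of \<open>\<nabla>\<^sub>X Y\<close> at \<open>x\<close> is \<open>Y'(x) (X x) + D c x (X x) (Y x)\<close>. The transformation law
  below says exactly that this expression is a vector field.\<close>

definition connection ::
  "('m, 'e::euclidean_space) chart set \<Rightarrow> ('m, 'e) christoffel \<Rightarrow> bool" where
  "connection A D \<longleftrightarrow>
     (\<forall>c\<in>A. \<forall>x\<in>chart_image c. bilinear (D c x)) \<and>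
     (\<forall>c\<in>A. \<forall>u v. smooth_on (chart_image c) (\<lambda>x. D c x u v)) \<and>
     (\<forall>c\<in>A. \<forall>d\<in>A. \<forall>x\<in>overlap c d. \<forall>u v.
        jac c d x (D c x u v) =
          frechet_derivative (\<lambda>y. jac c d y v) (at x) u
          + D d (transition c d x) (jac c d x u) (jac c d x v))"

text \<open>In the following three definitions the tensors \<open>T(X,Y) = \<nabla>\<^sub>X Y - \<nabla>\<^sub>Y X - [X,Y]\<close>,
  \<open>\<nabla>g\<close> and \<open>\<nabla>T\<close> are evaluated on vector fields with constant representatives in the chart.\<close>

definition torsion :: "('m, 'e::euclidean_space) christoffel \<Rightarrow> ('m, 'e) christoffel" where
  "torsion D c x u v = D c x u v - D c x v u"

definition metric_connection ::
  "('m, 'e::euclidean_space) chart set \<Rightarrow> ('m, 'e) form2 \<Rightarrow> ('m, 'e) christoffel \<Rightarrow> bool" where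
  "metric_connection A g D \<longleftrightarrow> connection A D \<and>
     (\<forall>c\<in>A. \<forall>x\<in>chart_image c. \<forall>u v w.
        frechet_derivative (\<lambda>y. g c y v w) (at x) u
          - g c x (D c x u v) w - g c x v (D c x u w) = 0)"

definition parallel_torsion ::
  "('m, 'e::euclidean_space) chart set \<Rightarrow> ('m, 'e) christoffel \<Rightarrow> bool" where
  "parallel_torsion A D \<longleftrightarrow>
     (\<forall>c\<in>A. \<forall>x\<in>chart_image c. \<forall>u v w.
        frechet_derivative (\<lambda>y. torsion D c y v w) (at x) u
          + D c x u (torsion D c x v w)
          - torsion D c x (D c x u v) w - torsion D c x v (D c x u w) = 0)"

definition levi_civita ::
  "('m, 'e::euclidean_space) chart set \<Rightarrow> ('m, 'e) form2 \<Rightarrow> ('m, 'e) christoffel \<Rightarrow> bool" where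
  "levi_civita A g D \<longleftrightarrow> metric_connection A g D \<and>
     (\<forall>c\<in>A. \<forall>x\<in>chart_image c. \<forall>u v. torsion D c x u v = 0)"

text \<open>The action of the bivector \<open>u \<and> v\<close> on \<open>w\<close>.\<close>

definition wedge :: "('e::euclidean_space \<Rightarrow> 'e \<Rightarrow> real) \<Rightarrow> 'e \<Rightarrow> 'e \<Rightarrow> 'e \<Rightarrow> 'e" where
  "wedge b u v w = b u w *\<^sub>R v - b v w *\<^sub>R u"

definition sharp :: "('e::euclidean_space \<Rightarrow> 'e \<Rightarrow> real) \<Rightarrow> ('e \<Rightarrow> real) \<Rightarrow> 'e" where
  "sharp b \<alpha> = (THE w. \<forall>z. b w z = \<alpha> z)"

text \<open>\<open>\<nabla>\<^sub>X = \<nabla>\<^sup>g\<^sub>X + X \<and> \<xi> + 1/2 S(X)\<close>, where \<open>Dg\<close> is the Levi-Civita connection \<open>\<nabla>\<^sup>g\<close> and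
  \<open>g(S(X)Y, Z) = S(X,Y,Z)\<close>.\<close>

definition twistor_free_connection ::
  "('m, 'e::euclidean_space) chart set \<Rightarrow> ('m, 'e) form2 \<Rightarrow> ('m, 'e) christoffel \<Rightarrow>
     ('m, 'e) christoffel \<Rightarrow> ('m, 'e) vector_field \<Rightarrow> ('m, 'e) form3 \<Rightarrow> bool" where
  "twistor_free_connection A g Dg D \<xi> S \<longleftrightarrow>
     metric_connection A g D \<and> smooth_vector_field A \<xi> \<and> three_form A S \<and>
     (\<forall>c\<in>A. \<forall>x\<in>chart_image c. \<forall>u v.
        D c x u v = Dg c x u v + wedge (g c x) u (\<xi> c x) v
                      + (1/2) *\<^sub>R sharp (g c x) (S c x u v))"

section \<open>Geodesics and completeness\<close>

definition velocity :: "('m, 'e::euclidean_space) chart \<Rightarrow> (real \<Rightarrow> 'm) \<Rightarrow> real \<Rightarrow> 'e" where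
  "velocity c \<gamma> t = vector_derivative (snd c \<circ> \<gamma>) (at t)"

text \<open>Twice differentiable solutions of the geodesic equation are automatically smooth.\<close>

definition geodesic ::
  "('m::topological_space, 'e::euclidean_space) chart set \<Rightarrow> ('m, 'e) christoffel \<Rightarrow>
     real set \<Rightarrow> (real \<Rightarrow> 'm) \<Rightarrow> bool" where
  "geodesic A D I \<gamma> \<longleftrightarrow>
     open I \<and> is_interval I \<and> I \<noteq> {} \<and> continuous_on I \<gamma> \<and>
     (\<forall>t\<in>I. \<forall>c\<in>A. \<gamma> t \<in> fst c \<longrightarrow>
        (snd c \<circ> \<gamma>) differentiable (at t) \<and>
        (velocity c \<gamma> has_vector_derivative
           - D c (snd c (\<gamma> t)) (velocity c \<gamma> t) (velocity c \<gamma> t)) (at t))"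

definition maximal_geodesic ::
  "('m::topological_space, 'e::euclidean_space) chart set \<Rightarrow> ('m, 'e) christoffel \<Rightarrow>
     real set \<Rightarrow> (real \<Rightarrow> 'm) \<Rightarrow> bool" where
  "maximal_geodesic A D I \<gamma> \<longleftrightarrow> geodesic A D I \<gamma> \<and>
     \<not> (\<exists>J \<delta>. I \<subset> J \<and> geodesic A D J \<delta> \<and> (\<forall>t\<in>I. \<delta> t = \<gamma> t))"

text \<open>Space-like for \<open>\<eta> = 1\<close>, time-like for \<open>\<eta> = -1\<close>, light-like for \<open>\<eta> = 0\<close>.\<close>

definition has_causal_type ::
  "('m, 'e::euclidean_space) chart set \<Rightarrow> ('m, 'e) form2 \<Rightarrow> real \<Rightarrow>
     real set \<Rightarrow> (real \<Rightarrow> 'm) \<Rightarrow> bool" where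
  "has_causal_type A g \<eta> I \<gamma> \<longleftrightarrow>
     (\<forall>t\<in>I. \<forall>c\<in>A. \<gamma> t \<in> fst c \<longrightarrow>
        velocity c \<gamma> t \<noteq> 0 \<and>
        sgn (g c (snd c (\<gamma> t)) (velocity c \<gamma> t) (velocity c \<gamma> t)) = \<eta>)"

definition geodesically_complete ::
  "('m::topological_space, 'e::euclidean_space) chart set \<Rightarrow> ('m, 'e) form2 \<Rightarrow>
     ('m, 'e) christoffel \<Rightarrow> real \<Rightarrow> bool" where
  "geodesically_complete A g Dg \<eta> \<longleftrightarrow>
     (\<forall>I \<gamma>. maximal_geodesic A Dg I \<gamma> \<and> has_causal_type A g \<eta> I \<gamma> \<longrightarrow> I = UNIV)"

end

theory Submission
  imports Defs
begin

text \<open>Parallel torsion forces \<open>\<nabla>\<xi> = 0\<close>. Hence along a \<open>\<nabla>\<^sup>g\<close>-geodesic \<open>\<gamma>\<close> the numbers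
  \<open>g(\<gamma>',\<gamma>')\<close> and \<open>g(\<xi>,\<xi>)\<close> are constant, and \<open>f = g(\<gamma>',\<xi>)\<close> solves the Riccati equation
  \<open>f' = g(\<gamma>',\<gamma>') g(\<xi>,\<xi>) - f\<^sup>2\<close>, because the skew-symmetric part of the torsion drops out. If the
  right-hand side is negative and \<open>f \<le> 0\<close> at one time, then \<open>f\<close> tends to \<open>-\<infinity>\<close> in finite time. For
  each causal type, a Lorentzian plane containing \<open>\<xi>\<close> contains initial velocities with this
  property, and maximal geodesics with a given initial velocity exist by Picard's theorem and
  Zorn's lemma.\<close>


section \<open>Lorentzian forms\<close>

lemma lorentzian_form_basis:
  fixes b :: "'e::euclidean_space \<Rightarrow> 'e \<Rightarrow> real"
  assumes "lorentzian_form b"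
  obtains E e0 where "finite E" "independent E" "span E = UNIV" "e0 \<in> E" "b e0 e0 = -1"
    "\<And>e. e \<in> E \<Longrightarrow> e \<noteq> e0 \<Longrightarrow> b e e = 1" "\<And>e. e \<in> E \<Longrightarrow> b e e \<noteq> 0"
    "\<And>e f. e \<in> E \<Longrightarrow> f \<in> E \<Longrightarrow> e \<noteq> f \<Longrightarrow> b e f = 0"
    "\<And>z. z = (\<Sum>e\<in>E. (b z e / b e e) *\<^sub>R e)"
proof -
  have bil: "bilinear b" using assms by (simp add: lorentzian_form_def)
  obtain E e0 where E: "independent E" "span E = UNIV" "e0 \<in> E" "b e0 e0 = -1"
      "\<forall>e\<in>E - {e0}. b e e = 1" "\<forall>e\<in>E. \<forall>f\<in>E. e \<noteq> f \<longrightarrow> b e f = 0"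
    using assms unfolding lorentzian_form_def by blast
  have fin: "finite E" using E(1) by (rule finiteI_independent)
  have nz: "b e e \<noteq> 0" if "e \<in> E" for e using that E(4,5) by (cases "e = e0") auto
  have "z = (\<Sum>e\<in>E. (b z e / b e e) *\<^sub>R e)" for z
  proof -
    obtain c where c: "z = (\<Sum>e\<in>E. c e *\<^sub>R e)"
      using span_finite[OF fin] E(2) by fastforce
    have "b z f = c f * b f f" if "f \<in> E" for f
    proof -
      interpret l: linear "\<lambda>x. b x f" using bil by (simp add: bilinear_def)
      have "b z f = (\<Sum>e\<in>E. c e * b e f)" by (simp add: c l.sum l.scale)
      also have "\<dots> = (\<Sum>e\<in>E. if e = f then c f * b f f else 0)"
        by (rule sum.cong) (use that E(6) in auto)
      finally show ?thesis using that fin by simp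
    qed
    then show ?thesis using nz by (subst c) (auto intro!: sum.cong)
  qed
  with fin E nz show ?thesis by (intro that[of E e0]) (blast | simp)+
qed

lemma lorentzian_form_nondegenerate:
  assumes b: "lorentzian_form b" and w: "\<And>z. b w z = 0"
  shows "w = 0"
proof -
  obtain E where "w = (\<Sum>e\<in>E. (b w e / b e e) *\<^sub>R e)"
    using lorentzian_form_basis[OF b] by metis
  then show ?thesis by (simp only: w) simp
qed

lemma lorentzian_form_sharp:
  assumes b: "lorentzian_form b" and \<alpha>: "linear \<alpha>"
  shows "b (sharp b \<alpha>) z = \<alpha> z"
proof -
  have bil: "bilinear b" and sym: "\<And>u v. b u v = b v u"
    using b by (auto simp: lorentzian_form_def)
  obtain E where fin: "finite E" and ex: "\<And>z. z = (\<Sum>e\<in>E. (b z e / b e e) *\<^sub>R e)"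
    using lorentzian_form_basis[OF b] by metis
  define w where "w = (\<Sum>e\<in>E. (\<alpha> e / b e e) *\<^sub>R e)"
  interpret a: linear \<alpha> by fact
  have w: "\<forall>z. b w z = \<alpha> z"
  proof
    fix z
    interpret l: linear "\<lambda>x. b x z" using bil by (simp add: bilinear_def)
    have "b w z = (\<Sum>e\<in>E. \<alpha> e / b e e * b z e)"
      unfolding w_def l.sum l.scale by (simp add: sym[of _ z])
    also have "\<dots> = \<alpha> (\<Sum>e\<in>E. (b z e / b e e) *\<^sub>R e)"
      by (auto simp: a.sum a.scale intro!: sum.cong)
    finally show "b w z = \<alpha> z" by (simp flip: ex)
  qed
  have "\<forall>z. b (sharp b \<alpha>) z = \<alpha> z"
    unfolding sharp_def
  proof (rule theI2[where a = w and Q = "\<lambda>w. \<forall>z. b w z = \<alpha> z"])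
    fix w' assume "\<forall>z. b w' z = \<alpha> z"
    then have "b (w' - w) z = 0" for z by (simp add: bilinear_lsub[OF bil] w)
    then have "w' - w = 0" by (rule lorentzian_form_nondegenerate[OF b])
    then show "w' = w" by simp
  qed (use w in simp_all)
  then show ?thesis by simp
qed

text \<open>The vector \<open>v\<close> lies in a Lorentzian plane containing \<open>\<xi>\<close>; the last inequality says that the
  Gram determinant of \<open>v\<close> and \<open>\<xi>\<close> is negative.\<close>

lemma lorentzian_form_causal_vector:
  fixes b :: "'e::euclidean_space \<Rightarrow> 'e \<Rightarrow> real"
  assumes b: "lorentzian_form b" and dim: "DIM('e) \<ge> 2" and \<xi>: "\<xi> \<noteq> 0" and \<eta>: "\<eta> \<in> {1, -1, 0}"
  obtains v where "sgn (b v v) = \<eta>" "b v \<xi> \<le> 0" "b v v * b \<xi> \<xi> < (b v \<xi>)\<^sup>2"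
proof -
  have bil: "bilinear b" and sym: "\<And>u v. b u v = b v u"
    using b by (auto simp: lorentzian_form_def)
  obtain E e0 where E: "finite E" "independent E" "span E = UNIV" "e0 \<in> E" "b e0 e0 = -1"
    "\<And>e. e \<in> E \<Longrightarrow> e \<noteq> e0 \<Longrightarrow> b e e = 1" and "\<And>e. e \<in> E \<Longrightarrow> b e e \<noteq> 0"
    and orth: "\<And>e f. e \<in> E \<Longrightarrow> f \<in> E \<Longrightarrow> e \<noteq> f \<Longrightarrow> b e f = 0"
    and ex: "\<And>z. z = (\<Sum>e\<in>E. (b z e / b e e) *\<^sub>R e)"
    by (rule lorentzian_form_basis[OF b]) (rule that; assumption)
  have pos: "b n n > 0" if "b n e0 = 0" "n \<noteq> 0" for n
  proof -
    interpret l: linear "b n" using bil by (simp add: bilinear_def)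
    have "b n n = b n (\<Sum>e\<in>E. (b n e / b e e) *\<^sub>R e)" by (simp flip: ex)
    also have "\<dots> = (\<Sum>e\<in>E. b n e / b e e * b n e)" by (simp add: l.sum l.scale)
    also have "\<dots> = (\<Sum>e\<in>E. (b n e)\<^sup>2)"
    proof (rule sum.cong)
      fix e assume "e \<in> E"
      then show "b n e / b e e * b n e = (b n e)\<^sup>2"
        using E(5,6) that(1) by (cases "e = e0") (auto simp: power2_eq_square)
    qed simp
    finally have s: "b n n = (\<Sum>e\<in>E. (b n e)\<^sup>2)" .
    obtain e where "e \<in> E" "b n e \<noteq> 0"
    proof (rule ccontr)
      assume "\<not> thesis"
      then have "\<And>e. e \<in> E \<Longrightarrow> b n e = 0" using that by blast
      then have "n = 0" by (subst ex) simp
      with \<open>n \<noteq> 0\<close> show False by simp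
    qed
    then show ?thesis unfolding s using E(1) by (intro sum_pos2[of E e]) auto
  qed
  obtain e1 \<alpha> \<beta> where e1: "b e1 e1 = 1" "b e0 e1 = 0" and dec: "\<xi> = \<alpha> *\<^sub>R e0 + \<beta> *\<^sub>R e1"
  proof (cases "\<xi> + b \<xi> e0 *\<^sub>R e0 = 0")
    case True
    have "card E = DIM('e)" using E(2,3) by (metis dim_UNIV dim_eq_card_independent dim_span)
    then have "E \<noteq> {e0}" using dim by auto
    then obtain e1 where e: "e1 \<in> E" "e1 \<noteq> e0" using E(4) by blast
    have "\<xi> = (- b \<xi> e0) *\<^sub>R e0 + 0 *\<^sub>R e1" using True by (simp add: eq_neg_iff_add_eq_0)
    then show ?thesis using E(6)[OF e] orth[OF E(4) e(1)] e(2) by (intro that[of e1 "- b \<xi> e0" 0]) auto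
  next
    case False
    define n where "n = \<xi> + b \<xi> e0 *\<^sub>R e0"
    have n0: "b n e0 = 0" using E(5) by (simp add: n_def bilinear_ladd[OF bil] bilinear_lmul[OF bil])
    have nn: "b n n > 0" using pos[OF n0] False by (simp add: n_def)
    define r where "r = sqrt (b n n)"
    have r: "r > 0" "r * r = b n n" using nn by (auto simp: r_def)
    show ?thesis
    proof (rule that[of "(1 / r) *\<^sub>R n" "- b \<xi> e0" r])
      show "b ((1 / r) *\<^sub>R n) ((1 / r) *\<^sub>R n) = 1"
        using r nn by (simp add: bilinear_lmul[OF bil] bilinear_rmul[OF bil] r(2)[symmetric])
      show "b e0 ((1 / r) *\<^sub>R n) = 0" using n0 by (simp add: sym[of e0] bilinear_lmul[OF bil])
      show "\<xi> = (- b \<xi> e0) *\<^sub>R e0 + r *\<^sub>R (1 / r) *\<^sub>R n" using r by (simp add: n_def)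
    qed
  qed
  have ab: "\<alpha> \<noteq> 0 \<or> \<beta> \<noteq> 0" using \<xi> dec by auto
  note bl = bilinear_ladd[OF bil] bilinear_lmul[OF bil] bilinear_radd[OF bil] bilinear_rmul[OF bil]
  have comp: "b (p *\<^sub>R e0 + q *\<^sub>R e1) (p' *\<^sub>R e0 + q' *\<^sub>R e1) = q * q' - p * p'" for p q p' q'
    using E(5) e1 sym[of e1 e0] by (simp add: bl)
  have "\<exists>p q. sgn (q * q - p * p) = \<eta> \<and> q * \<alpha> \<noteq> p * \<beta>"
  proof -
    consider "\<eta> = 1" "\<alpha> \<noteq> 0" | "\<eta> = 1" "\<alpha> = 0" | "\<eta> = -1" "\<beta> \<noteq> 0" | "\<eta> = -1" "\<beta> = 0"
      | "\<eta> = 0" "\<alpha> \<noteq> \<beta>" | "\<eta> = 0" "\<alpha> = \<beta>" using \<eta> by auto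
    then show ?thesis
    proof cases
      case 1 then show ?thesis by (intro exI[of _ 0] exI[of _ 1]) simp
    next
      case 2 then show ?thesis using ab by (intro exI[of _ 1] exI[of _ 2]) simp
    next
      case 3 then show ?thesis by (intro exI[of _ 1] exI[of _ 0]) simp
    next
      case 4 then show ?thesis using ab by (intro exI[of _ 2] exI[of _ 1]) simp
    next
      case 5 then show ?thesis by (intro exI[of _ 1] exI[of _ 1]) simp
    next
      case 6 then show ?thesis using ab by (intro exI[of _ 1] exI[of _ "-1"]) simp
    qed
  qed
  then obtain p q where pq: "sgn (q * q - p * p) = \<eta>" "q * \<alpha> \<noteq> p * \<beta>" by blast
  define v where "v = p *\<^sub>R e0 + q *\<^sub>R e1"
  have "(b v \<xi>)\<^sup>2 - b v v * b \<xi> \<xi> = (q * \<alpha> - p * \<beta>)\<^sup>2"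
    unfolding v_def dec comp by (simp add: power2_eq_square algebra_simps)
  then have 1: "b v v * b \<xi> \<xi> < (b v \<xi>)\<^sup>2"
    using pq(2) by (smt (verit) zero_less_power2)
  have 2: "sgn (b v v) = \<eta>" using pq(1) by (simp add: v_def comp)
  show ?thesis
  proof (cases "b v \<xi> \<le> 0")
    case True
    then show ?thesis using that 1 2 by blast
  next
    case False
    then show ?thesis using 1 2 by (intro that[of "- v"]) (simp_all add: bilinear_lneg[OF bil] bilinear_rneg[OF bil])
  qed
qed

section \<open>Two scalar differential equations\<close>

lemma linear_ode_sgn_on_segment:
  fixes y a :: "real \<Rightarrow> real"
  assumes "s \<le> t"
    and y: "\<And>u. u \<in> {s..t} \<Longrightarrow> (y has_real_derivative a u * y u) (at u)"
    and a: "continuous_on {s..t} a"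
  shows "sgn (y s) = sgn (y t)"
proof -
  obtain G where G: "\<And>u. u \<in> {s..t} \<Longrightarrow> (G has_vector_derivative a u) (at u within {s..t})"
    using antiderivative_continuous[OF a] by metis
  have "((\<lambda>u. y u * exp (- G u)) has_real_derivative 0) (at u within {s..t})"
    if u: "u \<in> {s..t}" for u
  proof -
    have "(G has_real_derivative a u) (at u within {s..t})"
      using G[OF u] by (simp add: has_real_derivative_iff_has_vector_derivative)
    moreover have "(y has_real_derivative a u * y u) (at u within {s..t})"
      using y[OF u] by (rule DERIV_subset) simp
    ultimately show ?thesis by (auto intro!: derivative_eq_intros simp: algebra_simps)
  qed
  then obtain c where c: "\<And>u. u \<in> {s..t} \<Longrightarrow> y u * exp (- G u) = c"
    using has_field_derivative_zero_constant[of "{s..t}" "\<lambda>u. y u * exp (- G u)"] by auto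
  have "sgn (y u) = sgn c" if "u \<in> {s..t}" for u
    using c[OF that] by (auto simp: sgn_mult)
  then show ?thesis using \<open>s \<le> t\<close> by simp
qed

lemma linear_ode_sgn:
  fixes y a :: "real \<Rightarrow> real"
  assumes "is_interval I" "s \<in> I" "t \<in> I"
    and "\<And>u. u \<in> I \<Longrightarrow> (y has_real_derivative a u * y u) (at u)"
    and "continuous_on I a"
  shows "sgn (y s) = sgn (y t)"
proof -
  have "sgn (y s) = sgn (y t)" if "s \<le> t" "s \<in> I" "t \<in> I" for s t
  proof -
    have "{s..t} \<subseteq> I" using that assms(1) by (intro subsetI) (meson atLeastAtMost_iff is_interval_1)
    then show ?thesis
      using that assms(4) continuous_on_subset[OF assms(5)]
      by (intro linear_ode_sgn_on_segment[of s t y a]) auto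
  qed
  then show ?thesis using assms(2,3) by (metis linear)
qed

text \<open>The quantity \<open>f\<^sup>2 - c\<close> satisfies the linear equation \<open>y' = -2 f y\<close>.\<close>

lemma riccati_discriminant_pos:
  fixes f :: "real \<Rightarrow> real"
  assumes I: "is_interval I" "s \<in> I" "t \<in> I"
    and f: "\<And>u. u \<in> I \<Longrightarrow> (f has_real_derivative c - (f u)\<^sup>2) (at u)"
    and s: "c < (f s)\<^sup>2"
  shows "c < (f t)\<^sup>2"
proof -
  have "continuous_on I f"
    using f by (meson DERIV_continuous continuous_at_imp_continuous_on)
  then have "continuous_on I (\<lambda>u. - 2 * f u)" by (intro continuous_intros)
  moreover have "((\<lambda>u. (f u)\<^sup>2 - c) has_real_derivative (- 2 * f u) * ((f u)\<^sup>2 - c)) (at u)"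
    if "u \<in> I" for u
    by (auto intro!: derivative_eq_intros f[OF that] simp: algebra_simps)
  ultimately have "sgn ((f s)\<^sup>2 - c) = sgn ((f t)\<^sup>2 - c)"
    using I by (intro linear_ode_sgn[where a = "\<lambda>u. - 2 * f u"]) auto
  with s show ?thesis by (simp add: sgn_if split: if_splits)
qed

lemma riccati_no_global_solution:
  fixes f :: "real \<Rightarrow> real"
  assumes f: "\<And>t. (f has_real_derivative c - (f t)\<^sup>2) (at t)"
    and f0: "f 0 \<le> 0" "c < (f 0)\<^sup>2"
  shows False
proof -
  have neg: "c < (f t)\<^sup>2" for t
    using riccati_discriminant_pos[of UNIV 0 t f c] f f0 by auto
  have anti: "f t < f s" if "s < t" for s t
  proof (rule DERIV_neg_imp_decreasing[OF that])
    fix u show "\<exists>y. (f has_real_derivative y) (at u) \<and> y < 0"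
      using f[of u] neg[of u] by (intro exI[of _ "c - (f u)\<^sup>2"]) simp
  qed
  have fneg: "f t < 0" if "t > 0" for t using anti[OF that] f0 by simp
  define \<delta> where "\<delta> = (f 0)\<^sup>2 - c"
  have \<delta>: "\<delta> > 0" using f0 by (simp add: \<delta>_def)
  have lin: "f t \<le> f 0 - \<delta> * t" if "t \<ge> 0" for t
  proof -
    have "(\<lambda>t. f t + \<delta> * t) t \<le> (\<lambda>t. f t + \<delta> * t) 0"
    proof (rule DERIV_nonpos_imp_nonincreasing[OF that])
      fix u :: real assume "0 \<le> u" "u \<le> t"
      then have "(f 0)\<^sup>2 \<le> (f u)\<^sup>2"
        using anti[of 0 u] f0 by (cases "u = 0") (auto simp: abs_le_square_iff[symmetric])
      moreover have "((\<lambda>t. f t + \<delta> * t) has_real_derivative c - (f u)\<^sup>2 + \<delta>) (at u)"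
        by (auto intro!: derivative_eq_intros f)
      ultimately show "\<exists>y. ((\<lambda>t. f t + \<delta> * t) has_real_derivative y) (at u) \<and> y \<le> 0"
        by (auto simp: \<delta>_def)
    qed
    then show ?thesis by simp
  qed
  define K where "K = 1 + 2 * \<bar>c\<bar>"
  define T where "T = K / \<delta>"
  have K: "K \<ge> 1" by (simp add: K_def)
  have T: "T > 0" using K \<delta> by (simp add: T_def)
  have fT: "f u \<le> - K" if "u \<ge> T" for u
  proof -
    have "f T \<le> - K" using lin[of T] T f0 \<delta> by (simp add: T_def)
    then show ?thesis using anti[of T u] that by (cases "u = T") auto
  qed
  have big: "1 / 2 \<le> 1 - c / (f u)\<^sup>2" if "u \<ge> T" for u
  proof -
    have "K \<le> \<bar>f u\<bar>" using fT[OF that] by simp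
    then have "K * K \<le> (f u)\<^sup>2" using K power_mono[of K "\<bar>f u\<bar>" 2] by (simp add: power2_eq_square)
    moreover have "K \<le> K * K" using K by simp
    ultimately have "2 * c \<le> (f u)\<^sup>2" "(f u)\<^sup>2 > 0" using K by (auto simp: K_def)
    then show ?thesis by (simp add: field_simps)
  qed
  have fu0: "f u \<noteq> 0" if "u \<ge> T" for u using fT[OF that] K by simp
  define t where "t = T + 2 - 2 * (1 / f T)"
  have t: "T \<le> t" using fneg[OF T] by (simp add: t_def divide_nonneg_neg less_imp_le)
       (smt (verit) divide_nonneg_neg)
  have "(\<lambda>u. 1 / f u - u / 2) T \<le> (\<lambda>u. 1 / f u - u / 2) t"
  proof (rule DERIV_nonneg_imp_nondecreasing[OF t])
    fix u assume u: "T \<le> u" "u \<le> t"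
    have "((\<lambda>u. 1 / f u - u / 2) has_real_derivative (1 - c / (f u)\<^sup>2) - 1 / 2) (at u)"
      using fu0[OF u(1)]
      by (auto intro!: derivative_eq_intros f simp: field_simps power2_eq_square)
    then show "\<exists>y. ((\<lambda>u. 1 / f u - u / 2) has_real_derivative y) (at u) \<and> 0 \<le> y"
      using big[OF u(1)] by (intro exI conjI) auto
  qed
  then have "1 / f t \<ge> 1 / f T + (t - T) / 2" by (simp add: diff_divide_distrib)
  moreover have "(t - T) / 2 = 1 - 1 / f T" by (simp add: t_def diff_divide_distrib)
  ultimately have "1 / f t \<ge> 1" by simp
  then show False using fneg[of t] t T by (smt (verit) zero_less_divide_1_iff)
qed

section \<open>Differentiation along curves\<close>

lemma has_vector_derivative_apply_linear:
  fixes G :: "real \<Rightarrow> 'a::euclidean_space \<Rightarrow> 'b::real_normed_vector"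
  assumes lin: "\<forall>\<^sub>F s in nhds t. linear (G s)"
    and G: "\<And>v. ((\<lambda>s. G s v) has_vector_derivative G' v) (at t)"
    and v: "(v has_vector_derivative w) (at t)"
  shows "((\<lambda>s. G s (v s)) has_vector_derivative G' (v t) + G t w) (at t)"
proof -
  let ?H = "\<lambda>s. G s (v t) + (\<Sum>b\<in>Basis. ((v s - v t) \<bullet> b) *\<^sub>R G s b)"
  have comp: "G s z = (\<Sum>b\<in>Basis. (z \<bullet> b) *\<^sub>R G s b)" if "linear (G s)" for s z
  proof -
    have "G s z = G s (\<Sum>b\<in>Basis. (z \<bullet> b) *\<^sub>R b)" by (simp add: euclidean_representation)
    then show ?thesis by (simp only: linear_sum[OF that] linear_scale[OF that])
  qed
  have "\<forall>\<^sub>F s in nhds t. G s (v s) = ?H s"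
    using lin
  proof eventually_elim
    case (elim s)
    have "G s (v s) = G s (v t) + G s (v s - v t)" by (simp flip: linear_add[OF elim])
    then show ?case using comp[OF elim, of "v s - v t"] by simp
  qed
  moreover have "G t (v t) = ?H t" by simp
  moreover have "(?H has_vector_derivative G' (v t) + (\<Sum>b\<in>Basis. (w \<bullet> b) *\<^sub>R G t b)) (at t)"
  proof -
    have "((\<lambda>s. (v s - v t) \<bullet> b) has_real_derivative w \<bullet> b) (at t)" for b
      unfolding has_real_derivative_iff_has_vector_derivative
      using bounded_linear.has_vector_derivative[OF bounded_linear_inner_left
          has_vector_derivative_diff[OF v has_vector_derivative_const]]
      by simp
    from has_vector_derivative_scaleR[OF this G]
    have "((\<lambda>s. ((v s - v t) \<bullet> b) *\<^sub>R G s b) has_vector_derivative (w \<bullet> b) *\<^sub>R G t b) (at t)" for b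
      by (simp)
    then show ?thesis by (intro has_vector_derivative_add has_vector_derivative_sum G)
  qed
  moreover have "(\<Sum>b\<in>Basis. (w \<bullet> b) *\<^sub>R G t b) = G t w"
    using comp eventually_nhds_x_imp_x[OF lin] by metis
  ultimately show ?thesis
    by (subst has_vector_derivative_cong_ev[where g = ?H]) (auto elim!: eventually_mono)
qed

lemma has_vector_derivative_apply_bilinear:
  fixes G :: "real \<Rightarrow> 'a::euclidean_space \<Rightarrow> 'c::euclidean_space \<Rightarrow> 'b::real_normed_vector"
  assumes lin: "\<forall>\<^sub>F s in nhds t. bilinear (G s)"
    and G: "\<And>u v. ((\<lambda>s. G s u v) has_vector_derivative G' u v) (at t)"
    and u: "(u has_vector_derivative u') (at t)"
    and v: "(v has_vector_derivative v') (at t)"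
  shows "((\<lambda>s. G s (u s) (v s)) has_vector_derivative G' (u t) (v t) + G t u' (v t) + G t (u t) v') (at t)"
proof (rule has_vector_derivative_apply_linear[where G = "\<lambda>s. G s (u s)"
        and G' = "\<lambda>v. G' (u t) v + G t u' v", OF _ _ v])
  show "\<forall>\<^sub>F s in nhds t. linear (G s (u s))"
    using lin by eventually_elim (simp add: bilinear_def)
  fix v
  show "((\<lambda>s. G s (u s) v) has_vector_derivative G' (u t) v + G t u' v) (at t)"
    by (rule has_vector_derivative_apply_linear[where G = "\<lambda>s u. G s u v" and G' = "\<lambda>u. G' u v", OF _ G u])
      (use lin in eventually_elim, simp add: bilinear_def)
qed

lemma has_vector_derivative_along_curve:
  assumes "F differentiable (at (x t))" "(x has_vector_derivative u) (at t)"
  shows "((\<lambda>s. F (x s)) has_vector_derivative frechet_derivative F (at (x t)) u) (at t)"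
proof -
  have F: "(F has_derivative frechet_derivative F (at (x t))) (at (x t))"
    using assms(1) by (simp add: frechet_derivative_works)
  show ?thesis
    using vector_derivative_diff_chain_within[of x u t UNIV F] assms(2) F
    by (auto simp: o_def intro: has_derivative_at_withinI)
qed


section \<open>Local solutions of ordinary differential equations\<close>

lemma picard_local_solution:
  fixes F :: "'a::euclidean_space \<Rightarrow> 'a"
  assumes r: "r > 0" and lip: "L-lipschitz_on (cball x0 r) F"
  obtains e x where "e > 0" "x 0 = x0" "\<And>t. t \<in> {-e<..<e} \<Longrightarrow> x t \<in> cball x0 r"
    "\<And>t. t \<in> {-e<..<e} \<Longrightarrow> (x has_vector_derivative F (x t)) (at t)"
proof -
  have L: "L \<ge> 0" using lip by (rule lipschitz_on_nonneg)
  define M where "M = norm (F x0) + L * r + 1"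
  have M: "M > 0" using L r by (simp add: M_def add_nonneg_pos)
  have FM: "norm (F y) \<le> M" if "y \<in> cball x0 r" for y
  proof -
    have "dist (F y) (F x0) \<le> L * dist y x0" using lip that r by (intro lipschitz_onD) auto
    also have "\<dots> \<le> L * r" using that L by (intro mult_left_mono) (auto simp: dist_commute)
    finally show ?thesis by (simp add: M_def dist_norm) (smt (verit) norm_triangle_sub)
  qed
  define e where "e = min (r / (4 * M)) (1 / (8 * (L + 1)))"
  have e: "e > 0" using r M L by (simp add: e_def)
  have eM: "4 * e * M \<le> r"
  proof -
    have "e \<le> r / (4 * M)" by (simp add: e_def)
    then show ?thesis using M by (simp add: field_simps)
  qed
  have eL: "4 * e * L \<le> 1 / 2"
  proof -
    have "e \<le> 1 / (8 * (L + 1))" by (simp add: e_def)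
    then have "e * (8 * (L + 1)) \<le> 1" using L by (simp add: field_simps)
    then show ?thesis using e by (simp add: algebra_simps)
  qed
  define cl where "cl t = max (-e) (min e t)" for t
  have cl: "cl t \<in> {-e..e}" for t using e by (auto simp: cl_def)
  define J where "J f t = integral {-e..t} (\<lambda>s. F (f s))" for f t
  define S where "S = PiC (UNIV :: real set) (\<lambda>_. cball x0 r)"
  define P where "P f = Bcontfun (\<lambda>t. x0 + (J f (cl t) - J f 0))" for f :: "real \<Rightarrow>\<^sub>C 'a"
  have S: "f \<in> S \<longleftrightarrow> (\<forall>t. apply_bcontfun f t \<in> cball x0 r)" for f
    by (auto simp: S_def mem_PiC_iff Pi_iff)
  have contF: "continuous_on X (\<lambda>s. F (apply_bcontfun f s))" if "f \<in> S" for f X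
    using that by (intro continuous_on_compose2[OF lipschitz_on_continuous_on[OF lip]]) (auto simp: S)
  have Jbound: "norm (J f t) \<le> 2 * e * M" if "f \<in> S" "t \<in> {-e..e}" for f t
  proof -
    have "norm (J f t) \<le> M * (t - (-e))"
      unfolding J_def using that by (intro integral_bound contF FM) (auto simp: S)
    also have "\<dots> \<le> M * (2 * e)" using that M by (intro mult_left_mono) auto
    finally show ?thesis by (simp add: mult_ac)
  qed
  have Jlip: "norm (J f t - J h t) \<le> 2 * e * L * dist f h"
    if "f \<in> S" "h \<in> S" "t \<in> {-e..e}" for f h t
  proof -
    have "J f t - J h t = integral {-e..t} (\<lambda>s. F (f s) - F (h s))"
      unfolding J_def using that
      by (intro integral_diff[symmetric] integrable_continuous_real contF)
    also have "norm \<dots> \<le> (L * dist f h) * (t - (-e))"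
    proof (rule integral_bound)
      fix s
      have "dist (F (f s)) (F (h s)) \<le> L * dist (f s) (h s)"
        using that by (intro lipschitz_onD[OF lip]) (auto simp: S)
      also have "\<dots> \<le> L * dist f h" using L by (intro mult_left_mono dist_bounded)
      finally show "norm (F (f s) - F (h s)) \<le> L * dist f h" by (simp add: dist_norm)
    qed (use that in \<open>auto intro!: continuous_intros contF\<close>)
    also have "\<dots> \<le> (L * dist f h) * (2 * e)" using that L by (intro mult_left_mono) auto
    finally show ?thesis by (simp add: mult_ac)
  qed
  have Jcont: "continuous_on {-e..e} (J f)" if "f \<in> S" for f
    unfolding J_def using that by (intro indefinite_integral_continuous_1 integrable_continuous_real contF)
  have near: "norm (J f (cl t) - J f 0) \<le> r" if "f \<in> S" for f t
  proof -
    have "norm (J f (cl t)) \<le> 2 * e * M" "norm (J f 0) \<le> 2 * e * M"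
      using Jbound[OF that] cl e by auto
    then show ?thesis using norm_triangle_ineq4[of "J f (cl t)" "J f 0"] eM by linarith
  qed
  have P: "apply_bcontfun (P f) t = x0 + (J f (cl t) - J f 0)" if "f \<in> S" for f t
  proof -
    have "(\<lambda>t. x0 + (J f (cl t) - J f 0)) \<in> bcontfun"
    proof (rule bcontfun_normI)
      show "continuous_on UNIV (\<lambda>t. x0 + (J f (cl t) - J f 0))"
        using cl by (intro continuous_intros continuous_on_compose2[OF Jcont[OF that], where f = cl])
          (auto simp: cl_def intro!: continuous_intros)
      show "norm (x0 + (J f (cl t) - J f 0)) \<le> norm x0 + r" for t
        using norm_triangle_ineq[of x0] near[OF that] by (smt (verit))
    qed
    then show ?thesis by (simp add: P_def Bcontfun_inverse)
  qed
  have PS: "P f \<in> S" if "f \<in> S" for f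
    using near[OF that] by (auto simp: S P[OF that] dist_norm norm_minus_commute)
  have "\<exists>!x\<in>S. P x = x"
  proof (rule Banach_fix[where c = "1/2"])
    show "complete S" unfolding S_def complete_eq_closed by (rule closed_PiC) simp
    have "const_bcontfun x0 \<in> S" using r by (simp add: S const_bcontfun.rep_eq)
    then show "S \<noteq> {}" by blast
    show "P ` S \<subseteq> S" using PS by blast
    fix f h assume fh: "f \<in> S" "h \<in> S"
    show "dist (P f) (P h) \<le> 1/2 * dist f h"
    proof (rule dist_bound)
      fix t
      have "dist (P f t) (P h t) = norm ((J f (cl t) - J h (cl t)) - (J f 0 - J h 0))"
        using fh by (simp add: P dist_norm algebra_simps)
      also have "\<dots> \<le> 4 * e * L * dist f h"
        using norm_triangle_ineq4[of "J f (cl t) - J h (cl t)" "J f 0 - J h 0"]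
          Jlip[OF fh cl, of t] Jlip[OF fh, of 0] e by simp
      also have "\<dots> \<le> 1/2 * dist f h" using eL by (intro mult_right_mono) auto
      finally show "dist (P f t) (P h t) \<le> 1/2 * dist f h" .
    qed
  qed auto
  then obtain x where x: "x \<in> S" "P x = x" by blast
  have xeq: "apply_bcontfun x t = x0 + (J x t - J x 0)" if "t \<in> {-e..e}" for t
    using P[OF x(1), of t] that by (simp add: x cl_def)
  show ?thesis
  proof (rule that[OF e, of "apply_bcontfun x"])
    show "apply_bcontfun x 0 = x0" using xeq[of 0] e by simp
    fix t assume t: "t \<in> {-e<..<e}"
    show "apply_bcontfun x t \<in> cball x0 r" using x(1) by (simp add: S)
    have "(J x has_vector_derivative F (x t)) (at t within {-e..e})"
      unfolding J_def using t by (intro integral_has_vector_derivative contF x) auto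
    then have "(J x has_vector_derivative F (x t)) (at t)"
      using t at_within_Icc_at[of "-e" t e] by simp
    then have "((\<lambda>t. x0 + (J x t - J x 0)) has_vector_derivative F (x t)) (at t)"
      by (auto intro!: derivative_eq_intros)
    then show "(apply_bcontfun x has_vector_derivative F (x t)) (at t)"
      by (rule has_vector_derivative_transform_within_open[where S = "{-e<..<e}"]) (use t xeq in auto)
  qed
qed

lemma C_k_on_imp_lipschitz:
  fixes f :: "'a::euclidean_space \<Rightarrow> 'b::real_normed_vector"
  assumes f: "C_k_on 1 U f" and X: "compact X" "convex X" "X \<subseteq> U"
  obtains L where "L \<ge> 0" "\<And>x y. x \<in> X \<Longrightarrow> y \<in> X \<Longrightarrow> norm (f x - f y) \<le> L * norm (x - y)"
proof -
  let ?D = "\<lambda>x. frechet_derivative f (at x)"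
  have D: "(f has_derivative ?D x) (at x)" if "x \<in> X" for x
    using f that X(3) by (auto simp flip: frechet_derivative_works)
  have "\<exists>B. \<forall>x\<in>X. norm (?D x v) \<le> B" for v
  proof -
    have "continuous_on X (\<lambda>x. ?D x v)" using f X(3) by (auto intro: continuous_on_subset)
    then have "compact ((\<lambda>x. ?D x v) ` X)" using X(1) by (rule compact_continuous_image)
    then show ?thesis by (auto dest!: compact_imp_bounded simp: bounded_iff)
  qed
  then obtain B where B: "\<And>v x. x \<in> X \<Longrightarrow> norm (?D x v) \<le> B v" by metis
  define L where "L = (\<Sum>b\<in>Basis. max 0 (B b))"
  have "norm (f x - f y) \<le> L * norm (x - y)" if "x \<in> X" "y \<in> X" for x y
  proof (rule differentiable_bound[OF X(2) _ _ that, where f' = ?D])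
    fix x assume x: "x \<in> X"
    then show "(f has_derivative ?D x) (at x within X)" by (rule has_derivative_at_withinI[OF D])
    show "onorm (?D x) \<le> L"
    proof (rule onorm_le)
      fix v :: 'a
      have lin: "linear (?D x)" using D[OF x] by (rule has_derivative_linear)
      have "?D x v = ?D x (\<Sum>b\<in>Basis. (v \<bullet> b) *\<^sub>R b)" by (simp add: euclidean_representation)
      also have "\<dots> = (\<Sum>b\<in>Basis. (v \<bullet> b) *\<^sub>R ?D x b)"
        by (simp only: linear_sum[OF lin] linear_scale[OF lin])
      also have "norm \<dots> \<le> (\<Sum>b\<in>Basis. norm v * max 0 (B b))"
        using B[OF x] by (intro sum_norm_le) (auto intro!: mult_mono Basis_le_norm simp: le_max_iff_disj)
      finally show "norm (?D x v) \<le> L * norm v" by (simp add: L_def sum_distrib_left mult.commute)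
    qed
  qed
  moreover have "L \<ge> 0" by (auto simp: L_def intro!: sum_nonneg)
  ultimately show ?thesis using that by blast
qed

lemma bilinear_norm_le:
  fixes h :: "'a::euclidean_space \<Rightarrow> 'c::euclidean_space \<Rightarrow> 'b::real_normed_vector"
  assumes h: "bilinear h" and B: "\<And>i j. i \<in> Basis \<Longrightarrow> j \<in> Basis \<Longrightarrow> norm (h i j) \<le> B i j"
  shows "norm (h u v) \<le> (\<Sum>i\<in>Basis. \<Sum>j\<in>Basis. B i j) * norm u * norm v"
proof -
  have "h u v = h (\<Sum>i\<in>Basis. (u \<bullet> i) *\<^sub>R i) (\<Sum>j\<in>Basis. (v \<bullet> j) *\<^sub>R j)"
    by (simp add: euclidean_representation)
  also have "\<dots> = (\<Sum>(i,j)\<in>Basis \<times> Basis. h ((u \<bullet> i) *\<^sub>R i) ((v \<bullet> j) *\<^sub>R j))"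
    by (rule bilinear_sum[OF h])
  also have "norm \<dots> \<le> (\<Sum>(i,j)\<in>Basis \<times> Basis. B i j * (norm u * norm v))"
  proof (rule sum_norm_le)
    fix p :: "'a \<times> 'c" assume "p \<in> Basis \<times> Basis"
    then obtain i j where p: "p = (i, j)" "i \<in> Basis" "j \<in> Basis" by auto
    have "\<bar>u \<bullet> i\<bar> * (\<bar>v \<bullet> j\<bar> * norm (h i j)) \<le> norm u * (norm v * B i j)"
      using p B[OF p(2,3)] by (intro mult_mono Basis_le_norm) auto
    then show "norm (case p of (i, j) \<Rightarrow> h ((u \<bullet> i) *\<^sub>R i) ((v \<bullet> j) *\<^sub>R j))
        \<le> (case p of (i, j) \<Rightarrow> B i j * (norm u * norm v))"
      by (simp add: p(1) bilinear_lmul[OF h] bilinear_rmul[OF h] mult_ac abs_mult)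
  qed
  also have "\<dots> = (\<Sum>i\<in>Basis. \<Sum>j\<in>Basis. B i j) * norm u * norm v"
    by (simp add: sum.cartesian_product sum_distrib_right mult.assoc case_prod_unfold)
  finally show ?thesis .
qed

lemma quadratic_spray_lipschitz:
  fixes \<Gamma> :: "'e::euclidean_space \<Rightarrow> 'e \<Rightarrow> 'e \<Rightarrow> 'e"
  assumes bil: "\<And>x. x \<in> U \<Longrightarrow> bilinear (\<Gamma> x)" and smooth: "\<And>u v. smooth_on U (\<lambda>x. \<Gamma> x u v)"
    and X: "cball x0 r \<subseteq> U" and r: "r > 0"
  obtains L where "L-lipschitz_on (cball (x0, v0) r) (\<lambda>(x, v). (v, - \<Gamma> x v v))"
proof -
  have C1: "C_k_on 1 U (\<lambda>x. \<Gamma> x i j)" and C0: "continuous_on U (\<lambda>x. \<Gamma> x i j)" for i j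
    using smooth[of i j] unfolding smooth_on_def by (blast, metis C_k_on.simps(1))
  have "\<exists>K\<ge>0. \<forall>x\<in>cball x0 r. \<forall>y\<in>cball x0 r. norm (\<Gamma> x i j - \<Gamma> y i j) \<le> K * norm (x - y)" for i j
    by (rule C_k_on_imp_lipschitz[OF C1[of i j] _ _ X]) (auto simp: mem_cball)
  then obtain K where K: "\<And>i j. K i j \<ge> 0" "\<And>i j x y. x \<in> cball x0 r \<Longrightarrow> y \<in> cball x0 r \<Longrightarrow>
      norm (\<Gamma> x i j - \<Gamma> y i j) \<le> K i j * norm (x - y)"
    by metis
  have "\<exists>B. \<forall>x\<in>cball x0 r. norm (\<Gamma> x i j) \<le> B" for i j
    using compact_imp_bounded[OF compact_continuous_image[OF continuous_on_subset[OF C0 X] compact_cball]]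
    by (auto simp: bounded_iff)
  then obtain B where B: "\<And>i j x. x \<in> cball x0 r \<Longrightarrow> norm (\<Gamma> x i j) \<le> B i j" by metis
  have B0: "B i j \<ge> 0" for i j using B[of x0] r by (meson centre_in_cball less_imp_le norm_ge_zero order_trans)
  define k where "k = (\<Sum>i\<in>Basis. \<Sum>j\<in>Basis. K i j)"
  define m where "m = (\<Sum>i\<in>Basis. \<Sum>j\<in>Basis. B i j)"
  have km: "k \<ge> 0" "m \<ge> 0" unfolding k_def m_def by (auto intro!: sum_nonneg K B0)
  define R where "R = norm v0 + r"
  have R: "R \<ge> 0" using r by (simp add: R_def)
  have \<Gamma>m: "norm (\<Gamma> x u v) \<le> m * norm u * norm v" if "x \<in> cball x0 r" for x u v
    unfolding m_def using that X B by (intro bilinear_norm_le bil) auto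
  have \<Gamma>k: "norm (\<Gamma> x u v - \<Gamma> y u v) \<le> k * norm (x - y) * norm u * norm v"
    if "x \<in> cball x0 r" "y \<in> cball x0 r" for x y u v
  proof -
    have b: "bilinear (\<Gamma> x)" "bilinear (\<Gamma> y)" using that X bil by auto
    have "bilinear (\<lambda>u v. \<Gamma> x u v - \<Gamma> y u v)"
      using b by (auto simp: bilinear_def intro: linear_compose_sub)
    from bilinear_norm_le[OF this K(2)[OF that]] show ?thesis
      by (simp add: k_def sum_distrib_right)
  qed
  define L where "L = 1 + (k * R * R + 2 * m * R)"
  have L: "L \<ge> 1" using km R by (simp add: L_def)
  have "L-lipschitz_on (cball (x0, v0) r) (\<lambda>(x, v). (v, - \<Gamma> x v v))"
  proof (rule lipschitz_onI)
    fix p q assume pq: "p \<in> cball (x0, v0) r" "q \<in> cball (x0, v0) r"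
    obtain x v y w where p: "p = (x, v)" and q: "q = (y, w)" by fastforce
    have xy: "x \<in> cball x0 r" "y \<in> cball x0 r"
      using pq dist_fst_le[of "(x0, v0)" p] dist_fst_le[of "(x0, v0)" q] by (auto simp: p q)
    have "dist v0 v \<le> r" "dist v0 w \<le> r"
      using pq dist_snd_le[of "(x0, v0)" p] dist_snd_le[of "(x0, v0)" q] by (auto simp: p q)
    then have vw: "norm v \<le> R" "norm w \<le> R"
      unfolding R_def by (smt (verit) dist_norm norm_minus_commute norm_triangle_sub)+
    define d where "d = dist p q"
    have d: "norm (x - y) \<le> d" "norm (v - w) \<le> d" "d \<ge> 0"
      using dist_fst_le[of p q] dist_snd_le[of p q] by (auto simp: p q d_def dist_norm)
    have b: "bilinear (\<Gamma> y)" using xy X bil by auto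
    have "\<Gamma> x v v - \<Gamma> y w w = (\<Gamma> x v v - \<Gamma> y v v) + (\<Gamma> y (v - w) v + \<Gamma> y w (v - w))"
      by (simp add: bilinear_lsub[OF b] bilinear_rsub[OF b])
    also have "norm \<dots> \<le> norm (\<Gamma> x v v - \<Gamma> y v v) + (norm (\<Gamma> y (v - w) v) + norm (\<Gamma> y w (v - w)))"
      by (meson add_left_mono norm_triangle_ineq order_trans)
    also have "\<dots> \<le> k * d * R * R + (m * d * R + m * R * d)"
    proof (intro add_mono)
      show "norm (\<Gamma> x v v - \<Gamma> y v v) \<le> k * d * R * R"
        by (rule order_trans[OF \<Gamma>k[OF xy]]) (intro mult_mono; use km R d vw in auto)
      show "norm (\<Gamma> y (v - w) v) \<le> m * d * R"
        by (rule order_trans[OF \<Gamma>m[OF xy(2)]]) (intro mult_mono; use km R d vw in auto)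
      show "norm (\<Gamma> y w (v - w)) \<le> m * R * d"
        by (rule order_trans[OF \<Gamma>m[OF xy(2)]]) (intro mult_mono; use km R d vw in auto)
    qed
    finally have 2: "norm (\<Gamma> x v v - \<Gamma> y w w) \<le> (k * R * R + 2 * m * R) * d"
      by (simp add: algebra_simps)
    have "dist (v, - \<Gamma> x v v) (w, - \<Gamma> y w w) \<le> norm (v - w) + norm (\<Gamma> x v v - \<Gamma> y w w)"
      using norm_Pair_le[of "v - w" "\<Gamma> y w w - \<Gamma> x v v"] by (simp add: dist_norm norm_minus_commute)
    also have "\<dots> \<le> L * d" using d 2 by (simp add: L_def algebra_simps)
    finally show "dist (case p of (x, v) \<Rightarrow> (v, - \<Gamma> x v v)) (case q of (x, v) \<Rightarrow> (v, - \<Gamma> x v v)) \<le> L * dist p q"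
      by (simp add: p q d_def)
  qed (use L in simp)
  then show ?thesis using that by blast
qed

lemma geodesic_equation_local_solution:
  fixes \<Gamma> :: "'e::euclidean_space \<Rightarrow> 'e \<Rightarrow> 'e \<Rightarrow> 'e"
  assumes U: "open U" "x0 \<in> U"
    and bil: "\<And>x. x \<in> U \<Longrightarrow> bilinear (\<Gamma> x)" and smooth: "\<And>u v. smooth_on U (\<lambda>x. \<Gamma> x u v)"
  obtains e x v where "e > 0" "x 0 = x0" "v 0 = v0" "\<And>t. t \<in> {-e<..<e} \<Longrightarrow> x t \<in> U"
    "\<And>t. t \<in> {-e<..<e} \<Longrightarrow> (x has_vector_derivative v t) (at t)"
    "\<And>t. t \<in> {-e<..<e} \<Longrightarrow> (v has_vector_derivative - \<Gamma> (x t) (v t) (v t)) (at t)"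
proof -
  obtain r where r: "r > 0" "cball x0 r \<subseteq> U" using U open_contains_cball by blast
  obtain L where L: "L-lipschitz_on (cball (x0, v0) r) (\<lambda>(x, v). (v, - \<Gamma> x v v))"
    using quadratic_spray_lipschitz[OF bil smooth r(2,1)] by blast
  obtain e z where e: "e > 0" "z 0 = (x0, v0)" "\<And>t. t \<in> {-e<..<e} \<Longrightarrow> z t \<in> cball (x0, v0) r"
    "\<And>t. t \<in> {-e<..<e} \<Longrightarrow> (z has_vector_derivative (\<lambda>(x, v). (v, - \<Gamma> x v v)) (z t)) (at t)"
    by (rule picard_local_solution[OF r(1) L]) (rule that; assumption)
  show ?thesis
  proof (rule that[of e "\<lambda>t. fst (z t)" "\<lambda>t. snd (z t)"])
    fix t assume t: "t \<in> {-e<..<e}"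
    show "fst (z t) \<in> U" using e(3)[OF t] r(2) dist_fst_le[of "(x0, v0)" "z t"] by (auto simp: subset_iff)
    note d = e(4)[OF t, unfolded case_prod_unfold]
    show "((\<lambda>t. fst (z t)) has_vector_derivative snd (z t)) (at t)"
      using bounded_linear.has_vector_derivative[OF bounded_linear_fst d] by simp
    show "((\<lambda>t. snd (z t)) has_vector_derivative - \<Gamma> (fst (z t)) (snd (z t)) (snd (z t))) (at t)"
      using bounded_linear.has_vector_derivative[OF bounded_linear_snd d] by simp
  qed (use e in auto)
qed


section \<open>Charts and transition maps\<close>

lemma smooth_atlas_inj_on:
  assumes "smooth_atlas A" "c \<in> A"
  shows "inj_on (snd c) (fst c)"
  using assms unfolding smooth_atlas_def homeomorphism_def by (metis inj_on_inverseI)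

lemma smooth_atlas_continuous_on:
  assumes "smooth_atlas A" "c \<in> A"
  shows "continuous_on (fst c) (snd c)"
  using assms unfolding smooth_atlas_def homeomorphism_def by blast

lemma smooth_atlas_continuous_on_inv:
  assumes "smooth_atlas A" "c \<in> A"
  shows "continuous_on (chart_image c) (inv_into (fst c) (snd c))"
proof -
  obtain h where h: "homeomorphism (fst c) (chart_image c) (snd c) h"
    using assms unfolding smooth_atlas_def by blast
  have "inv_into (fst c) (snd c) y = h y" if "y \<in> chart_image c" for y
    using h that smooth_atlas_inj_on[OF assms] unfolding homeomorphism_def
    by (metis imageI inv_into_f_f)
  then show ?thesis using homeomorphism_cont2[OF h] by (simp cong: continuous_on_cong)
qed

lemma transition_eq:
  assumes "smooth_atlas A" "c \<in> A" "p \<in> fst c"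
  shows "transition c d (snd c p) = snd d p"
  using assms by (simp add: transition_def inv_into_f_f[OF smooth_atlas_inj_on])

lemma overlapI: "p \<in> fst c \<Longrightarrow> p \<in> fst d \<Longrightarrow> snd c p \<in> overlap c d"
  by (simp add: overlap_def)

lemma chart_imageI: "p \<in> fst c \<Longrightarrow> snd c p \<in> chart_image c"
  by (simp add: chart_image_def)

lemma smooth_atlas_open:
  assumes "smooth_atlas A" "c \<in> A"
  shows "open (fst c)" "open (chart_image c)"
  using assms by (auto simp: smooth_atlas_def)

lemma smooth_on_imp_differentiable:
  assumes "smooth_on U f" "x \<in> U"
  shows "f differentiable (at x)"
  using assms unfolding smooth_on_def by (metis C_k_on.simps(2))

lemma smooth_atlas_transition:
  assumes "smooth_atlas A" "c \<in> A" "d \<in> A" "x \<in> overlap c d"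
  shows "transition c d differentiable (at x)" "linear (jac c d x)"
    "(\<lambda>y. jac c d y v) differentiable (at x)"
proof -
  have s: "smooth_on (overlap c d) (transition c d)" using assms by (simp add: smooth_atlas_def)
  then show t: "transition c d differentiable (at x)"
    using assms(4) by (rule smooth_on_imp_differentiable)
  then show "linear (jac c d x)"
    unfolding jac_def by (auto simp: frechet_derivative_works dest: has_derivative_linear)
  have "C_k_on (Suc (Suc 0)) (overlap c d) (transition c d)" using s by (simp only: smooth_on_def)
  then show "(\<lambda>y. jac c d y v) differentiable (at x)"
    using assms(4) by (simp add: jac_def)
qed

lemma isCont_eventually_mem_open:
  assumes "isCont \<gamma> t" "\<gamma> t \<in> U" "open U"
  shows "\<forall>\<^sub>F s in nhds t. \<gamma> s \<in> U"
proof -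
  have "(\<gamma> \<longlongrightarrow> \<gamma> t) (nhds t)"
    using assms(1) by (simp add: isCont_def tendsto_at_iff_tendsto_nhds)
  then show ?thesis using assms(3,2) by (rule topological_tendstoD)
qed

lemma velocity_has_vector_derivative:
  "(snd c \<circ> \<gamma>) differentiable (at t) \<longleftrightarrow> (snd c \<circ> \<gamma> has_vector_derivative velocity c \<gamma> t) (at t)"
  unfolding velocity_def by (simp add: vector_derivative_works)

lemma velocity_eqI: "(snd c \<circ> \<gamma> has_vector_derivative v) (at t) \<Longrightarrow> velocity c \<gamma> t = v"
  unfolding velocity_def by (rule vector_derivative_at)

lemma velocity_change_of_chart:
  assumes A: "smooth_atlas A" "c \<in> A" "d \<in> A" and \<gamma>: "isCont \<gamma> t" "\<gamma> t \<in> fst c" "\<gamma> t \<in> fst d"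
    and v: "(snd c \<circ> \<gamma> has_vector_derivative v) (at t)"
  shows "(snd d \<circ> \<gamma> has_vector_derivative jac c d (snd c (\<gamma> t)) v) (at t)"
proof -
  have "\<forall>\<^sub>F s in nhds t. \<gamma> s \<in> fst c"
    using \<gamma>(1,2) smooth_atlas_open(1)[OF A(1,2)] by (rule isCont_eventually_mem_open)
  then have "\<forall>\<^sub>F s in nhds t. (snd d \<circ> \<gamma>) s = transition c d ((snd c \<circ> \<gamma>) s)"
    by eventually_elim (simp add: transition_eq[OF A(1,2)])
  moreover have "((\<lambda>s. transition c d ((snd c \<circ> \<gamma>) s)) has_vector_derivative
      jac c d (snd c (\<gamma> t)) v) (at t)"
    using has_vector_derivative_along_curve[OF _ v, of "transition c d"]
      smooth_atlas_transition(1)[OF A overlapI[OF \<gamma>(2,3)]] by (simp add: jac_def)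
  ultimately show ?thesis
    by (subst has_vector_derivative_cong_ev[where g = "\<lambda>s. transition c d ((snd c \<circ> \<gamma>) s)"])
      (auto elim: eventually_mono dest: eventually_nhds_x_imp_x)
qed

section \<open>Existence of maximal geodesics\<close>

definition geodesic_at ::
  "('m::topological_space, 'e::euclidean_space) chart set \<Rightarrow> ('m, 'e) christoffel \<Rightarrow>
     (real \<Rightarrow> 'm) \<Rightarrow> real \<Rightarrow> bool" where
  "geodesic_at A D \<gamma> t \<longleftrightarrow> isCont \<gamma> t \<and>
     (\<forall>c\<in>A. \<gamma> t \<in> fst c \<longrightarrow>
        (snd c \<circ> \<gamma>) differentiable (at t) \<and>
        (velocity c \<gamma> has_vector_derivative
           - D c (snd c (\<gamma> t)) (velocity c \<gamma> t) (velocity c \<gamma> t)) (at t))"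

lemma geodesic_iff_geodesic_at:
  "geodesic A D I \<gamma> \<longleftrightarrow> open I \<and> is_interval I \<and> I \<noteq> {} \<and> (\<forall>t\<in>I. geodesic_at A D \<gamma> t)"
  unfolding geodesic_def geodesic_at_def by (auto simp: continuous_on_eq_continuous_at)

lemma velocity_cong:
  assumes "open J" "t \<in> J" "\<And>s. s \<in> J \<Longrightarrow> \<gamma> s = \<delta> s"
  shows "velocity c \<gamma> t = velocity c \<delta> t"
proof -
  have "(snd c \<circ> \<gamma> has_vector_derivative v) (at t) \<longleftrightarrow> (snd c \<circ> \<delta> has_vector_derivative v) (at t)" for v
    using assms by (auto elim!: has_vector_derivative_transform_within_open)
  then show ?thesis by (simp add: velocity_def vector_derivative_def)
qed

lemma geodesic_at_cong:
  assumes J: "open J" "t \<in> J" and eq: "\<And>s. s \<in> J \<Longrightarrow> \<gamma> s = \<delta> s" and \<gamma>: "geodesic_at A D \<gamma> t"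
  shows "geodesic_at A D \<delta> t"
  unfolding geodesic_at_def
proof (intro conjI ballI impI)
  have "isCont \<gamma> t" using \<gamma> by (simp add: geodesic_at_def)
  moreover have "\<forall>\<^sub>F s in nhds t. \<gamma> s = \<delta> s" using J eq by (auto simp: eventually_nhds)
  ultimately show "isCont \<delta> t" by (simp cong: isCont_cong)
next
  fix c assume c: "c \<in> A" "\<delta> t \<in> fst c"
  have g: "(snd c \<circ> \<gamma> has_vector_derivative velocity c \<gamma> t) (at t)"
    "(velocity c \<gamma> has_vector_derivative
           - D c (snd c (\<gamma> t)) (velocity c \<gamma> t) (velocity c \<gamma> t)) (at t)"
    using \<gamma> c eq[OF J(2)] by (auto simp: geodesic_at_def velocity_has_vector_derivative)
  have veq: "velocity c \<gamma> s = velocity c \<delta> s" if "s \<in> J" for s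
    using velocity_cong[OF J(1) that eq] .
  have "(snd c \<circ> \<delta> has_vector_derivative velocity c \<delta> t) (at t)"
    using has_vector_derivative_transform_within_open[OF g(1) J, of "snd c \<circ> \<delta>"] eq veq[OF J(2)] by simp
  then show "(snd c \<circ> \<delta>) differentiable (at t)" by (simp add: velocity_has_vector_derivative)
  show "(velocity c \<delta> has_vector_derivative
           - D c (snd c (\<delta> t)) (velocity c \<delta> t) (velocity c \<delta> t)) (at t)"
    using has_vector_derivative_transform_within_open[OF g(2) J veq] eq[OF J(2)] veq[OF J(2)] by simp
qed

lemma exists_maximal_geodesic:
  assumes g0: "geodesic A D I0 \<gamma>0"
  obtains I \<gamma> where "maximal_geodesic A D I \<gamma>" "I0 \<subseteq> I" "\<And>t. t \<in> I0 \<Longrightarrow> \<gamma> t = \<gamma>0 t"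
proof -
  define graph where "graph I \<gamma> = (\<lambda>t. (t, \<gamma> t)) ` I" for I :: "real set" and \<gamma> :: "real \<Rightarrow> 'a"
  define G where "G = {M. \<exists>I \<gamma>. geodesic A D I \<gamma> \<and> M = graph I \<gamma> \<and> graph I0 \<gamma>0 \<subseteq> M}"
  have graph_le: "graph I \<gamma> \<subseteq> graph J \<delta> \<longleftrightarrow> I \<subseteq> J \<and> (\<forall>t\<in>I. \<delta> t = \<gamma> t)" for I J \<gamma> \<delta>
    by (auto simp: graph_def)
  obtain t0 where t0: "t0 \<in> I0" using g0 by (auto simp: geodesic_iff_geodesic_at)
  have "\<exists>M\<in>G. \<forall>X\<in>G. M \<subseteq> X \<longrightarrow> X = M"
  proof (rule subset_Zorn_nonempty)
    show "G \<noteq> {}" using g0 by (auto simp: G_def)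
    fix C assume C: "C \<noteq> {}" "subset.chain G C"
    have "\<forall>M\<in>C. \<exists>I \<gamma>. geodesic A D I \<gamma> \<and> M = graph I \<gamma> \<and> graph I0 \<gamma>0 \<subseteq> M"
      using C(2) by (auto simp: G_def subset.chain_def)
    then obtain dom cur where dc: "\<And>M. M \<in> C \<Longrightarrow> geodesic A D (dom M) (cur M)"
        "\<And>M. M \<in> C \<Longrightarrow> M = graph (dom M) (cur M)" "\<And>M. M \<in> C \<Longrightarrow> graph I0 \<gamma>0 \<subseteq> M"
      by metis
    have sub: "\<forall>t\<in>dom M. cur N t = cur M t" if "M \<in> C" "N \<in> C" "M \<subseteq> N" for M N
      using that(3)
      by (subst (asm) dc(2)[OF that(1)], subst (asm) dc(2)[OF that(2)]) (simp add: graph_le)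
    have agree: "cur M t = cur N t" if "M \<in> C" "N \<in> C" "t \<in> dom M" "t \<in> dom N" for M N t
    proof -
      have "M \<subseteq> N \<or> N \<subseteq> M" using C(2) that by (auto simp: subset.chain_def)
      then show ?thesis using sub[OF that(1,2)] sub[OF that(2,1)] that(3,4) by auto
    qed
    define I where "I = (\<Union>M\<in>C. dom M)"
    define \<gamma> where "\<gamma> t = cur (SOME M. M \<in> C \<and> t \<in> dom M) t" for t
    have \<gamma>: "cur M t = \<gamma> t" if "M \<in> C" "t \<in> dom M" for M t
    proof -
      have "(SOME M. M \<in> C \<and> t \<in> dom M) \<in> C \<and> t \<in> dom (SOME M. M \<in> C \<and> t \<in> dom M)"
        using that by (intro someI_ex[where P = "\<lambda>M. M \<in> C \<and> t \<in> dom M"]) blast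
      then show ?thesis unfolding \<gamma>_def using that by (intro agree) auto
    qed
    have t0M: "t0 \<in> dom M" if "M \<in> C" for M
    proof -
      have "graph I0 \<gamma>0 \<subseteq> graph (dom M) (cur M)"
        using dc(3)[OF that] by (subst (asm) dc(2)[OF that])
      then show ?thesis using t0 by (auto simp: graph_le)
    qed
    have "geodesic A D I \<gamma>"
      unfolding geodesic_iff_geodesic_at
    proof (intro conjI ballI)
      show "open I" unfolding I_def using dc(1) by (auto simp: geodesic_iff_geodesic_at)
      show "I \<noteq> {}" using C(1) t0M by (auto simp: I_def)
      have "connected (\<Union>(dom ` C))"
      proof (rule connected_Union)
        show "connected J" if "J \<in> dom ` C" for J
          using that dc(1) by (auto simp: geodesic_iff_geodesic_at is_interval_connected_1)
        have "t0 \<in> \<Inter> (dom ` C)" using t0M by blast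
        then show "\<Inter> (dom ` C) \<noteq> {}" by blast
      qed
      then show "is_interval I" by (simp add: I_def is_interval_connected_1)
      fix t assume "t \<in> I"
      then obtain M where M: "M \<in> C" "t \<in> dom M" by (auto simp: I_def)
      have "open (dom M)" "geodesic_at A D (cur M) t"
        using dc(1)[OF M(1)] M(2) by (auto simp: geodesic_iff_geodesic_at)
      then show "geodesic_at A D \<gamma> t"
        using M \<gamma>[OF M(1)] geodesic_at_cong[of "dom M" t "cur M" \<gamma>] by blast
    qed
    moreover have "\<Union>C = graph I \<gamma>"
    proof -
      have "M = (\<lambda>t. (t, \<gamma> t)) ` dom M" if "M \<in> C" for M
        by (subst dc(2)[OF that]) (auto simp: graph_def \<gamma>[OF that])
      then have "\<Union>C = (\<Union>M\<in>C. (\<lambda>t. (t, \<gamma> t)) ` dom M)" by auto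
      then show ?thesis by (simp add: graph_def I_def image_UN)
    qed
    moreover have "graph I0 \<gamma>0 \<subseteq> \<Union>C" using C(1) dc(3) by blast
    ultimately show "\<Union>C \<in> G" by (auto simp: G_def)
  qed
  then obtain M where M: "M \<in> G" "\<And>X. X \<in> G \<Longrightarrow> M \<subseteq> X \<Longrightarrow> X = M" by blast
  then obtain I \<gamma> where I: "geodesic A D I \<gamma>" "M = graph I \<gamma>" "graph I0 \<gamma>0 \<subseteq> graph I \<gamma>"
    by (auto simp: G_def)
  have "\<not> (\<exists>J \<delta>. I \<subset> J \<and> geodesic A D J \<delta> \<and> (\<forall>t\<in>I. \<delta> t = \<gamma> t))"
  proof
    assume "\<exists>J \<delta>. I \<subset> J \<and> geodesic A D J \<delta> \<and> (\<forall>t\<in>I. \<delta> t = \<gamma> t)"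
    then obtain J \<delta> where J: "I \<subset> J" "geodesic A D J \<delta>" "\<forall>t\<in>I. \<delta> t = \<gamma> t" by blast
    then have le: "graph I \<gamma> \<subseteq> graph J \<delta>" using graph_le by blast
    then have "graph J \<delta> \<in> G" using J(2) I(3) by (auto simp: G_def)
    then have "graph J \<delta> = graph I \<gamma>" using M(2) le I(2) by blast
    then show False using J(1) graph_le by blast
  qed
  then show ?thesis using that[of I \<gamma>] I graph_le by (auto simp: maximal_geodesic_def)
qed

lemma connection_bilinear:
  assumes "connection A D" "c \<in> A" "x \<in> chart_image c"
  shows "bilinear (D c x)"
  using assms by (simp add: connection_def)

lemma exists_local_geodesic:
  assumes A: "smooth_atlas A" and D: "connection A D" and c: "c \<in> A" and p: "p \<in> fst c"
  obtains e \<gamma> where "e > 0" "geodesic A D {-e<..<e} \<gamma>" "\<gamma> 0 = p" "velocity c \<gamma> 0 = v"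
proof -
  have smooth: "smooth_on (chart_image c) (\<lambda>x. D c x u w)" for u w
    using D c by (simp add: connection_def)
  obtain e x w where e: "e > 0" "x 0 = snd c p" "w 0 = v"
    and U: "\<And>t. t \<in> {-e<..<e} \<Longrightarrow> x t \<in> chart_image c"
    and x: "\<And>t. t \<in> {-e<..<e} \<Longrightarrow> (x has_vector_derivative w t) (at t)"
    and w: "\<And>t. t \<in> {-e<..<e} \<Longrightarrow> (w has_vector_derivative - D c (x t) (w t) (w t)) (at t)"
    by (rule geodesic_equation_local_solution[of "chart_image c" "snd c p" "D c" v,
        OF smooth_atlas_open(2)[OF A c] chart_imageI[of p c, OF p] connection_bilinear[OF D c] smooth])
      (assumption, (rule that; assumption))
  define I where "I = {-e<..<e}"
  define \<gamma> where "\<gamma> t = inv_into (fst c) (snd c) (x t)" for t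
  have I: "open I" "is_interval I" "I \<noteq> {}" "0 \<in> I"
    using e(1) by (auto simp: I_def is_interval_oo)
  have \<gamma>c: "\<gamma> t \<in> fst c" and xc: "snd c (\<gamma> t) = x t" if "t \<in> I" for t
    using U that by (auto simp: \<gamma>_def I_def chart_image_def inv_into_into f_inv_into_f)
  have "continuous_on I x"
    using has_vector_derivative_continuous[OF x]
    by (auto simp: I_def intro!: continuous_at_imp_continuous_on)
  then have "continuous_on I \<gamma>"
    unfolding \<gamma>_def
    by (rule continuous_on_compose2[OF smooth_atlas_continuous_on_inv[OF A c]]) (auto simp: I_def U)
  then have cont: "isCont \<gamma> t" if "t \<in> I" for t
    using that I(1) by (simp add: continuous_on_eq_continuous_at)
  have vel: "(snd c \<circ> \<gamma> has_vector_derivative w t) (at t)" if "t \<in> I" for t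
    by (rule has_vector_derivative_transform_within_open[OF x I(1)]) (use that xc in \<open>auto simp: I_def\<close>)
  have "geodesic_at A D \<gamma> t" if t: "t \<in> I" for t
    unfolding geodesic_at_def
  proof (intro conjI ballI impI)
    show "isCont \<gamma> t" using t by (rule cont)
    fix d assume d: "d \<in> A" "\<gamma> t \<in> fst d"
    define J where "J = I \<inter> \<gamma> -` fst d"
    have J: "open J" "t \<in> J"
      using \<open>continuous_on I \<gamma>\<close> I(1) smooth_atlas_open(1)[OF A d(1)] t d(2)
      by (auto simp: J_def continuous_on_open_vimage Int_commute)
    have veld: "(snd d \<circ> \<gamma> has_vector_derivative jac c d (x s) (w s)) (at s)" if "s \<in> J" for s
    proof -
      have s: "s \<in> I" "\<gamma> s \<in> fst d" using that by (auto simp: J_def)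
      show ?thesis
        using velocity_change_of_chart[OF A c d(1) cont[OF s(1)] \<gamma>c[OF s(1)] s(2) vel[OF s(1)]] xc[OF s(1)]
        by simp
    qed
    show "(snd d \<circ> \<gamma>) differentiable (at t)" using veld[OF J(2)] by (rule differentiableI_vector)
    have ov: "x s \<in> overlap c d" if "s \<in> J" for s
      using overlapI[of "\<gamma> s" c d] \<gamma>c[of s] xc[of s] that by (auto simp: J_def)
    have "((\<lambda>s. jac c d (x s) (w s)) has_vector_derivative
        frechet_derivative (\<lambda>y. jac c d y (w t)) (at (x t)) (w t)
          + jac c d (x t) (- D c (x t) (w t) (w t))) (at t)"
    proof (rule has_vector_derivative_apply_linear[where
          G' = "\<lambda>u. frechet_derivative (\<lambda>y. jac c d y u) (at (x t)) (w t)"])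
      show "\<forall>\<^sub>F s in nhds t. linear (jac c d (x s))"
        using J smooth_atlas_transition(2)[OF A c d(1) ov] by (auto simp: eventually_nhds)
      show "((\<lambda>s. jac c d (x s) u) has_vector_derivative
          frechet_derivative (\<lambda>y. jac c d y u) (at (x t)) (w t)) (at t)" for u
      proof (rule has_vector_derivative_along_curve)
        show "(\<lambda>y. jac c d y u) differentiable (at (x t))"
          by (rule smooth_atlas_transition(3)[OF A c d(1) ov[OF J(2)]])
        show "(x has_vector_derivative w t) (at t)" using x t by (simp add: I_def)
      qed
      show "(w has_vector_derivative - D c (x t) (w t) (w t)) (at t)" using w t by (simp add: I_def)
    qed
    moreover have "jac c d (x t) (D c (x t) (w t) (w t)) =
          frechet_derivative (\<lambda>y. jac c d y (w t)) (at (x t)) (w t)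
          + D d (transition c d (x t)) (jac c d (x t) (w t)) (jac c d (x t) (w t))"
      using D c d(1) ov[OF J(2)] by (simp add: connection_def)
    ultimately have "((\<lambda>s. jac c d (x s) (w s)) has_vector_derivative
        - D d (transition c d (x t)) (jac c d (x t) (w t)) (jac c d (x t) (w t))) (at t)"
      by (simp add: linear_neg[OF smooth_atlas_transition(2)[OF A c d(1) ov[OF J(2)]]])
    moreover have "transition c d (x t) = snd d (\<gamma> t)"
      using transition_eq[OF A c \<gamma>c[OF t]] xc[OF t] by simp
    moreover have "velocity d \<gamma> s = jac c d (x s) (w s)" if "s \<in> J" for s
      using velocity_eqI[OF veld[OF that]] .
    ultimately show "(velocity d \<gamma> has_vector_derivative
           - D d (snd d (\<gamma> t)) (velocity d \<gamma> t) (velocity d \<gamma> t)) (at t)"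
      using J by (auto elim: has_vector_derivative_transform_within_open)
  qed
  then have "geodesic A D {-e<..<e} \<gamma>" using I by (simp add: geodesic_iff_geodesic_at I_def)
  moreover have "\<gamma> 0 = p"
    using e(2) p inv_into_f_f[OF smooth_atlas_inj_on[OF A c]] by (simp add: \<gamma>_def)
  moreover have "velocity c \<gamma> 0 = v" using velocity_eqI[OF vel[OF I(4)]] e(3) by simp
  ultimately show ?thesis using that e(1) by blast
qed


section \<open>Quantities along a geodesic\<close>

lemma metric_connection_along_curve:
  assumes A: "smooth_atlas A" and g: "lorentzian_metric A g" and D: "metric_connection A g D"
    and c: "c \<in> A" "x t \<in> chart_image c"
    and x: "(x has_vector_derivative u) (at t)"
    and a: "(a has_vector_derivative a') (at t)" and b: "(b has_vector_derivative b') (at t)"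
  shows "((\<lambda>s. g c (x s) (a s) (b s)) has_vector_derivative
      g c (x t) (a' + D c (x t) u (a t)) (b t) + g c (x t) (a t) (b' + D c (x t) u (b t))) (at t)"
proof -
  have bil: "bilinear (g c y)" if "y \<in> chart_image c" for y
    using g c(1) that by (simp add: lorentzian_metric_def lorentzian_form_def)
  have diff: "(\<lambda>y. g c y v w) differentiable (at (x t))" for v w
    using g c by (intro smooth_on_imp_differentiable[where U = "chart_image c"])
      (auto simp: lorentzian_metric_def)
  have dg: "frechet_derivative (\<lambda>y. g c y v w) (at (x t)) u
      = g c (x t) (D c (x t) u v) w + g c (x t) v (D c (x t) u w)" for v w
    using D c by (simp add: metric_connection_def algebra_simps)
  have "\<forall>\<^sub>F s in nhds t. x s \<in> chart_image c"
    using has_vector_derivative_continuous[OF x] c(2) smooth_atlas_open(2)[OF A c(1)]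
    by (rule isCont_eventually_mem_open)
  then have ev: "\<forall>\<^sub>F s in nhds t. bilinear (g c (x s))" by eventually_elim (rule bil)
  have "((\<lambda>s. g c (x s) (a s) (b s)) has_vector_derivative
      (g c (x t) (D c (x t) u (a t)) (b t) + g c (x t) (a t) (D c (x t) u (b t)))
        + g c (x t) a' (b t) + g c (x t) (a t) b') (at t)"
  proof (rule has_vector_derivative_apply_bilinear[OF ev _ a b,
        where G' = "\<lambda>v w. g c (x t) (D c (x t) u v) w + g c (x t) v (D c (x t) u w)"])
    fix v w
    show "((\<lambda>s. g c (x s) v w) has_vector_derivative
        g c (x t) (D c (x t) u v) w + g c (x t) v (D c (x t) u w)) (at t)"
      using has_vector_derivative_along_curve[OF diff x] by (simp add: dg)
  qed
  then show ?thesis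
    by (simp add: bilinear_ladd[OF bil[OF c(2)]] bilinear_radd[OF bil[OF c(2)]] algebra_simps)
qed

text \<open>A function \<open>Q\<close> on the tangent bundle, given by its representatives in the charts, evaluated
  on the velocity of a curve.\<close>

definition on_velocity ::
  "('m, 'e::euclidean_space) chart set \<Rightarrow> (('m, 'e) chart \<Rightarrow> 'e \<Rightarrow> 'e \<Rightarrow> real) \<Rightarrow>
     (real \<Rightarrow> 'm) \<Rightarrow> real \<Rightarrow> real" where
  "on_velocity A Q \<gamma> t =
     (let c = SOME c. c \<in> A \<and> \<gamma> t \<in> fst c in Q c (snd c (\<gamma> t)) (velocity c \<gamma> t))"

definition tangent_function ::
  "('m, 'e::euclidean_space) chart set \<Rightarrow> (('m, 'e) chart \<Rightarrow> 'e \<Rightarrow> 'e \<Rightarrow> real) \<Rightarrow> bool" where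
  "tangent_function A Q \<longleftrightarrow> (\<forall>c\<in>A. \<forall>d\<in>A. \<forall>x\<in>overlap c d. \<forall>v.
     Q d (transition c d x) (jac c d x v) = Q c x v)"

lemma on_velocity_eq:
  assumes A: "smooth_atlas A" and Q: "tangent_function A Q" and \<gamma>: "geodesic_at A D \<gamma> t"
    and d: "d \<in> A" "\<gamma> t \<in> fst d"
  shows "on_velocity A Q \<gamma> t = Q d (snd d (\<gamma> t)) (velocity d \<gamma> t)"
proof -
  define c where "c = (SOME c. c \<in> A \<and> \<gamma> t \<in> fst c)"
  have c: "c \<in> A" "\<gamma> t \<in> fst c"
    unfolding c_def using someI_ex[where P = "\<lambda>c. c \<in> A \<and> \<gamma> t \<in> fst c"] d by blast+
  have \<gamma>': "isCont \<gamma> t" "(snd c \<circ> \<gamma> has_vector_derivative velocity c \<gamma> t) (at t)"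
    using \<gamma> c by (auto simp: geodesic_at_def velocity_has_vector_derivative)
  have "velocity d \<gamma> t = jac c d (snd c (\<gamma> t)) (velocity c \<gamma> t)"
    by (rule velocity_eqI[OF velocity_change_of_chart[OF A c(1) d(1) \<gamma>'(1) c(2) d(2) \<gamma>'(2)]])
  moreover have "Q d (transition c d (snd c (\<gamma> t))) (jac c d (snd c (\<gamma> t)) (velocity c \<gamma> t))
      = Q c (snd c (\<gamma> t)) (velocity c \<gamma> t)"
    using Q c(1) d(1) overlapI[OF c(2) d(2)] unfolding tangent_function_def by blast
  ultimately show ?thesis
    by (simp add: on_velocity_def Let_def transition_eq[OF A c] flip: c_def)
qed

lemma on_velocity_has_derivative:
  assumes A: "smooth_atlas A" and Q: "tangent_function A Q" and \<gamma>: "geodesic A D I \<gamma>" and t: "t \<in> I"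
    and c: "c \<in> A" "\<gamma> t \<in> fst c"
    and r: "((\<lambda>s. Q c (snd c (\<gamma> s)) (velocity c \<gamma> s)) has_vector_derivative r) (at t)"
  shows "(on_velocity A Q \<gamma> has_real_derivative r) (at t)"
proof -
  define J where "J = I \<inter> \<gamma> -` fst c"
  have J: "open J" "t \<in> J"
    using \<gamma> smooth_atlas_open(1)[OF A c(1)] t c(2)
    by (auto simp: J_def geodesic_def continuous_on_open_vimage Int_commute)
  have "on_velocity A Q \<gamma> s = Q c (snd c (\<gamma> s)) (velocity c \<gamma> s)" if "s \<in> J" for s
    using that \<gamma> c(1)
    by (intro on_velocity_eq[OF A Q, where D = D]) (auto simp: J_def geodesic_iff_geodesic_at)
  then show ?thesis
    unfolding has_real_derivative_iff_has_vector_derivative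
    using has_vector_derivative_transform_within_open[OF r J, of "on_velocity A Q \<gamma>"] by simp
qed

lemma lorentzian_form_mult_eq_imp_zero:
  fixes b :: "'e::euclidean_space \<Rightarrow> 'e \<Rightarrow> real"
  assumes b: "lorentzian_form b" and dim: "DIM('e) \<ge> 2"
    and eq: "\<And>v w. b z v * b w w = b z w * b v w"
  shows "z = 0"
proof -
  obtain E e0 where E: "finite E" "independent E" "span E = UNIV" and "e0 \<in> E" "b e0 e0 = -1"
    "\<And>e. e \<in> E \<Longrightarrow> e \<noteq> e0 \<Longrightarrow> b e e = 1" and nz: "\<And>e. e \<in> E \<Longrightarrow> b e e \<noteq> 0"
    and orth: "\<And>e f. e \<in> E \<Longrightarrow> f \<in> E \<Longrightarrow> e \<noteq> f \<Longrightarrow> b e f = 0"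
    and ex: "\<And>z. z = (\<Sum>e\<in>E. (b z e / b e e) *\<^sub>R e)"
    by (rule lorentzian_form_basis[OF b]) (rule that; assumption)
  have "b z e = 0" if e: "e \<in> E" for e
  proof -
    have "card E = DIM('e)" using E(2,3) by (metis dim_UNIV dim_eq_card_independent dim_span)
    then have "E \<noteq> {e}" using dim by auto
    then obtain f where f: "f \<in> E" "f \<noteq> e" using e by blast
    then show ?thesis using eq[of e f] orth[OF e f(1)] nz[OF f(1)] by auto
  qed
  then show ?thesis by (subst ex) simp
qed

section \<open>Parallel twistor-free torsion\<close>

locale twistor_free_parallel =
  fixes A :: "('m::{t2_space, second_countable_topology}, 'e::euclidean_space) chart set"
    and g :: "('m, 'e) form2"
    and Dg D :: "('m, 'e) christoffel"
    and \<xi> :: "('m, 'e) vector_field"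
    and S :: "('m, 'e) form3"
  assumes lorentzian: "lorentzian_manifold A g"
    and levi_civita: "levi_civita A g Dg"
    and twistor_free: "twistor_free_connection A g Dg D \<xi> S"
    and parallel: "parallel_torsion A D"
begin

lemma dim: "DIM('e) \<ge> 2" and atlas: "smooth_atlas A" and metric: "lorentzian_metric A g"
  using lorentzian by (auto simp: lorentzian_manifold_def)

lemma Dg_metric: "metric_connection A g Dg" and D_metric: "metric_connection A g D"
  and \<xi>: "smooth_vector_field A \<xi>" and S: "three_form A S"
  using levi_civita twistor_free by (auto simp: levi_civita_def twistor_free_connection_def)

context
  fixes c :: "('m, 'e) chart" and x :: 'e
  assumes c: "c \<in> A" and x: "x \<in> chart_image c"
begin

lemma form: "lorentzian_form (g c x)"
  using metric c x by (simp add: lorentzian_metric_def)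

lemma bil: "bilinear (g c x)" and sym: "g c x u v = g c x v u"
  using form by (auto simp: lorentzian_form_def)

lemma S_skew: "S c x v u w = - S c x u v w" "S c x u w v = - S c x u v w" "S c x u v v = 0" "S c x u u w = 0"
proof -
  have *: "S c x v u w = - S c x u v w \<and> S c x u w v = - S c x u v w" for u v w
    using S c x unfolding three_form_def by blast
  show "S c x v u w = - S c x u v w" "S c x u w v = - S c x u v w" using * by blast+
  have "S c x u v v = - S c x u v v" "S c x u u w = - S c x u u w" using * by blast+
  then show "S c x u v v = 0" "S c x u u w = 0" by simp_all
qed

lemma S_linear: "linear (S c x u v)"
proof -
  have "bilinear (S c x u)" using S c x unfolding three_form_def by blast
  then show ?thesis by (simp add: bilinear_def)
qed

lemmas bil_simps = bilinear_ladd[OF bil] bilinear_radd[OF bil] bilinear_lsub[OF bil]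
  bilinear_rsub[OF bil] bilinear_lmul[OF bil] bilinear_rmul[OF bil] bilinear_lneg[OF bil]
  bilinear_rneg[OF bil] bilinear_lzero[OF bil] bilinear_rzero[OF bil]

lemma g_D:
  "g c x (D c x u v) z = g c x (Dg c x u v) z + g c x u v * g c x (\<xi> c x) z
     - g c x (\<xi> c x) v * g c x u z + S c x u v z / 2"
proof -
  have "D c x u v = Dg c x u v + wedge (g c x) u (\<xi> c x) v + (1/2) *\<^sub>R sharp (g c x) (S c x u v)"
    using twistor_free c x by (simp add: twistor_free_connection_def)
  then show ?thesis
    using lorentzian_form_sharp[OF form S_linear[of u v], of z] by (simp add: wedge_def bil_simps)
qed

lemma g_torsion:
  "g c x (torsion D c x v w) z = g c x (\<xi> c x) v * g c x w z - g c x (\<xi> c x) w * g c x v z + S c x v w z"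
proof -
  have "Dg c x v w = Dg c x w v"
    using levi_civita c x by (auto simp: levi_civita_def torsion_def)
  then show ?thesis
    by (simp add: torsion_def bil_simps g_D S_skew(1)[of w v] sym[of w v])
qed

lemma \<xi>_differentiable: "\<xi> c differentiable (at x)"
  using \<xi> c x by (intro smooth_on_imp_differentiable[where U = "chart_image c"])
    (auto simp: smooth_vector_field_def)

lemma torsion_differentiable: "(\<lambda>y. torsion D c y v w) differentiable (at x)"
proof -
  have "(\<lambda>y. D c y v w) differentiable (at x)" for v w
    using D_metric c x by (intro smooth_on_imp_differentiable[where U = "chart_image c"])
      (auto simp: metric_connection_def connection_def)
  then show ?thesis unfolding torsion_def by (intro derivative_intros)
qed

end

text \<open>Obtained by differentiating \<open>g (T(v,w), w) = g(\<xi>,v) g(w,w) - g(\<xi>,w) g(v,w)\<close>, where the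
  skew-symmetric part of the torsion does not contribute.\<close>

lemma \<xi>_parallel:
  assumes c: "c \<in> A" and x: "x \<in> chart_image c"
  shows "frechet_derivative (\<xi> c) (at x) u + D c x u (\<xi> c x) = 0"
proof (rule lorentzian_form_mult_eq_imp_zero[OF form[OF c x] dim])
  fix v w
  define z where "z = frechet_derivative (\<xi> c) (at x) u + D c x u (\<xi> c x)"
  let ?l = "\<lambda>s::real. x + s *\<^sub>R u"
  let ?T = "torsion D c x"
  have l: "(?l has_vector_derivative u) (at 0)" by (auto intro!: derivative_eq_intros)
  have l0: "?l 0 \<in> chart_image c" using x by simp
  note along = metric_connection_along_curve[OF atlas metric D_metric c l0 l, simplified]
  have T': "((\<lambda>s. torsion D c (?l s) v w) has_vector_derivative
      frechet_derivative (\<lambda>y. torsion D c y v w) (at x) u) (at 0)"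
    using has_vector_derivative_along_curve[OF _ l, of "\<lambda>y. torsion D c y v w"]
      torsion_differentiable[OF c x] by simp
  have \<xi>': "((\<lambda>s. \<xi> c (?l s)) has_vector_derivative frechet_derivative (\<xi> c) (at x) u) (at 0)"
    using has_vector_derivative_along_curve[OF _ l, of "\<xi> c"] \<xi>_differentiable[OF c x] by simp
  have const: "((\<lambda>s. y) has_vector_derivative 0) (at 0)" for y :: 'e by simp
  have DT: "frechet_derivative (\<lambda>y. torsion D c y v w) (at x) u + D c x u (?T v w)
      = ?T (D c x u v) w + ?T v (D c x u w)"
    using parallel c x by (simp add: parallel_torsion_def algebra_simps)
  have L: "((\<lambda>s. g c (?l s) (torsion D c (?l s) v w) w) has_vector_derivative
      g c x (?T (D c x u v) w + ?T v (D c x u w)) w + g c x (?T v w) (D c x u w)) (at 0)"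
    using along[OF T' const, of w] by (simp add: DT)
  have th: "((\<lambda>s. g c (?l s) (\<xi> c (?l s)) y) has_vector_derivative
      g c x z y + g c x (\<xi> c x) (D c x u y)) (at 0)" for y
    using along[OF \<xi>' const, of y] by (simp add: z_def)
  have gg: "((\<lambda>s. g c (?l s) y y') has_vector_derivative
      g c x (D c x u y) y' + g c x y (D c x u y')) (at 0)" for y y'
    using along[OF const const, of y y'] by simp
  have R: "((\<lambda>s. g c (?l s) (\<xi> c (?l s)) v * g c (?l s) w w - g c (?l s) (\<xi> c (?l s)) w * g c (?l s) v w)
    has_vector_derivative
      (g c x (\<xi> c x) v * (g c x (D c x u w) w + g c x w (D c x u w))
        + (g c x z v + g c x (\<xi> c x) (D c x u v)) * g c x w w)
      - (g c x (\<xi> c x) w * (g c x (D c x u v) w + g c x v (D c x u w))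
        + (g c x z w + g c x (\<xi> c x) (D c x u w)) * g c x v w)) (at 0)"
    using has_vector_derivative_diff[OF has_vector_derivative_mult[OF th gg] has_vector_derivative_mult[OF th gg],
        of v w w w v w] by simp
  have "\<forall>\<^sub>F s in nhds 0. ?l s \<in> chart_image c"
    using has_vector_derivative_continuous[OF l] l0 smooth_atlas_open(2)[OF atlas c]
    by (rule isCont_eventually_mem_open)
  then have ev: "\<forall>\<^sub>F s in nhds 0. g c (?l s) (torsion D c (?l s) v w) w
      = g c (?l s) (\<xi> c (?l s)) v * g c (?l s) w w - g c (?l s) (\<xi> c (?l s)) w * g c (?l s) v w"
    by eventually_elim (simp add: g_torsion[OF c] S_skew(3)[OF c])
  have R': "((\<lambda>s. g c (?l s) (torsion D c (?l s) v w) w) has_vector_derivative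
      (g c x (\<xi> c x) v * (g c x (D c x u w) w + g c x w (D c x u w))
        + (g c x z v + g c x (\<xi> c x) (D c x u v)) * g c x w w)
      - (g c x (\<xi> c x) w * (g c x (D c x u v) w + g c x v (D c x u w))
        + (g c x z w + g c x (\<xi> c x) (D c x u w)) * g c x v w)) (at 0)"
    using R
    by (subst has_vector_derivative_cong_ev[where g = "\<lambda>s. g c (?l s) (\<xi> c (?l s)) v * g c (?l s) w w
          - g c (?l s) (\<xi> c (?l s)) w * g c (?l s) v w"])
      (use ev in \<open>auto elim: eventually_mono dest: eventually_nhds_x_imp_x\<close>)
  have "g c x z v * g c x w w = g c x z w * g c x v w"
    using vector_derivative_unique_at[OF L R']
    by (simp add: bil_simps[OF c x] g_torsion[OF c x] S_skew(3)[OF c x] S_skew(2)[OF c x, of v "D c x u w" w]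
        sym[OF c x, of w "D c x u w"] algebra_simps)
  then show "g c x (frechet_derivative (\<xi> c) (at x) u + D c x u (\<xi> c x)) v * g c x w w
      = g c x (frechet_derivative (\<xi> c) (at x) u + D c x u (\<xi> c x)) w * g c x v w"
    by (simp add: z_def)
qed

abbreviation "energy \<equiv> on_velocity A (\<lambda>c x v. g c x v v)"
abbreviation "sq_norm_\<xi> \<equiv> on_velocity A (\<lambda>c x v. g c x (\<xi> c x) (\<xi> c x))"
abbreviation "component_\<xi> \<equiv> on_velocity A (\<lambda>c x v. g c x v (\<xi> c x))"

lemma tangent_functions:
  "tangent_function A (\<lambda>c x v. g c x v v)" "tangent_function A (\<lambda>c x v. g c x (\<xi> c x) (\<xi> c x))"
  "tangent_function A (\<lambda>c x v. g c x v (\<xi> c x))"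
  using metric \<xi> by (auto simp: tangent_function_def lorentzian_metric_def smooth_vector_field_def)

lemma derivatives_along_geodesic:
  assumes \<gamma>: "geodesic A Dg I \<gamma>" and t: "t \<in> I"
  shows "(energy \<gamma> has_real_derivative 0) (at t)" "(sq_norm_\<xi> \<gamma> has_real_derivative 0) (at t)"
    "(component_\<xi> \<gamma> has_real_derivative energy \<gamma> t * sq_norm_\<xi> \<gamma> t - (component_\<xi> \<gamma> t)\<^sup>2) (at t)"
proof -
  obtain c where c: "c \<in> A" "\<gamma> t \<in> fst c" using atlas unfolding smooth_atlas_def by blast
  let ?x = "\<lambda>s. snd c (\<gamma> s)" and ?u = "velocity c \<gamma>"
  have x: "?x t \<in> chart_image c" by (rule chart_imageI[of "\<gamma> t" c, OF c(2)])
  have g_at: "geodesic_at A Dg \<gamma> t" using \<gamma> t by (simp add: geodesic_iff_geodesic_at)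
  have x': "(?x has_vector_derivative ?u t) (at t)"
    and u': "(?u has_vector_derivative - Dg c (?x t) (?u t) (?u t)) (at t)"
    using g_at c velocity_has_vector_derivative[of c \<gamma> t] by (auto simp: geodesic_at_def o_def)
  have \<xi>': "((\<lambda>s. \<xi> c (?x s)) has_vector_derivative frechet_derivative (\<xi> c) (at (?x t)) (?u t)) (at t)"
    by (rule has_vector_derivative_along_curve[OF \<xi>_differentiable[OF c(1) x] x'])
  note bs = bil_simps[OF c(1) x]
  note der = on_velocity_has_derivative[OF atlas _ \<gamma> t c]
  note eqs = on_velocity_eq[OF atlas _ g_at c]
  have "((\<lambda>s. g c (?x s) (?u s) (?u s)) has_vector_derivative 0) (at t)"
    using metric_connection_along_curve[OF atlas metric Dg_metric c(1) x x' u' u'] by (simp add: bs)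
  then show "(energy \<gamma> has_real_derivative 0) (at t)" by (rule der[OF tangent_functions(1)])
  have "((\<lambda>s. g c (?x s) (\<xi> c (?x s)) (\<xi> c (?x s))) has_vector_derivative 0) (at t)"
    using metric_connection_along_curve[OF atlas metric D_metric c(1) x x' \<xi>' \<xi>']
    by (simp add: bs \<xi>_parallel[OF c(1) x])
  then show "(sq_norm_\<xi> \<gamma> has_real_derivative 0) (at t)" by (rule der[OF tangent_functions(2)])
  have "((\<lambda>s. g c (?x s) (?u s) (\<xi> c (?x s))) has_vector_derivative
      energy \<gamma> t * sq_norm_\<xi> \<gamma> t - (component_\<xi> \<gamma> t)\<^sup>2) (at t)"
    using metric_connection_along_curve[OF atlas metric D_metric c(1) x x' u' \<xi>']
    by (simp add: bs \<xi>_parallel[OF c(1) x] g_D[OF c(1) x] eqs[OF tangent_functions(1)]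
        eqs[OF tangent_functions(2)] eqs[OF tangent_functions(3)] S_skew(4)[OF c(1) x]
        sym[OF c(1) x, of "\<xi> c (?x t)" "?u t"] power2_eq_square)
  then show "(component_\<xi> \<gamma> has_real_derivative energy \<gamma> t * sq_norm_\<xi> \<gamma> t - (component_\<xi> \<gamma> t)\<^sup>2) (at t)"
    by (rule der[OF tangent_functions(3)])
qed

lemma not_geodesically_complete:
  assumes nz: "\<forall>c\<in>A. \<forall>x\<in>chart_image c. \<xi> c x \<noteq> 0" and \<eta>: "\<eta> \<in> {1, -1, 0}"
  shows "\<not> geodesically_complete A g Dg \<eta>"
proof
  assume complete: "geodesically_complete A g Dg \<eta>"
  obtain p :: 'm and c where c: "c \<in> A" "p \<in> fst c"
    using atlas unfolding smooth_atlas_def by (metis UNIV_I UN_iff)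
  have x: "snd c p \<in> chart_image c" using c(2) by (rule chart_imageI)
  obtain v where v: "sgn (g c (snd c p) v v) = \<eta>" "g c (snd c p) v (\<xi> c (snd c p)) \<le> 0"
    "g c (snd c p) v v * g c (snd c p) (\<xi> c (snd c p)) (\<xi> c (snd c p)) < (g c (snd c p) v (\<xi> c (snd c p)))\<^sup>2"
    using lorentzian_form_causal_vector[OF form[OF c(1) x] dim _ \<eta>] nz c(1) x by metis
  have "connection A Dg" using Dg_metric by (simp add: metric_connection_def)
  then obtain e \<gamma>0 where e: "e > 0" and \<gamma>0: "geodesic A Dg {-e<..<e} \<gamma>0" "\<gamma>0 0 = p" "velocity c \<gamma>0 0 = v"
    using exists_local_geodesic[OF atlas _ c] by metis
  obtain I \<gamma> where max: "maximal_geodesic A Dg I \<gamma>" and sub: "{-e<..<e} \<subseteq> I"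
    and ext: "\<And>t. t \<in> {-e<..<e} \<Longrightarrow> \<gamma> t = \<gamma>0 t"
    using exists_maximal_geodesic[OF \<gamma>0(1)] by metis
  have \<gamma>: "geodesic A Dg I \<gamma>" using max by (simp add: maximal_geodesic_def)
  then have I: "open I" "is_interval I" and g_at: "\<And>t. t \<in> I \<Longrightarrow> geodesic_at A Dg \<gamma> t"
    by (auto simp: geodesic_iff_geodesic_at)
  have 0: "0 \<in> I" "\<gamma> 0 = p" "velocity c \<gamma> 0 = v"
    using e sub ext[of 0] \<gamma>0 velocity_cong[of "{-e<..<e}" 0 \<gamma> \<gamma>0 c] ext by auto
  note start = on_velocity_eq[OF atlas _ g_at[OF 0(1)] c(1), unfolded 0, OF _ c(2)]
  let ?E = "energy \<gamma> 0" and ?k = "sq_norm_\<xi> \<gamma> 0"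
  have const: "F t = F 0" if "\<And>t. t \<in> I \<Longrightarrow> (F has_real_derivative 0) (at t)" "t \<in> I" for F :: "real \<Rightarrow> real" and t
    using has_field_derivative_zero_constant[of I F] that 0(1) I(2)
    by (metis has_field_derivative_at_within is_interval_convex)
  have E: "energy \<gamma> t = ?E" and k: "sq_norm_\<xi> \<gamma> t = ?k" if "t \<in> I" for t
    using const[OF derivatives_along_geodesic(1)[OF \<gamma>] that] const[OF derivatives_along_geodesic(2)[OF \<gamma>] that] by auto
  have f: "(component_\<xi> \<gamma> has_real_derivative ?E * ?k - (component_\<xi> \<gamma> t)\<^sup>2) (at t)" if "t \<in> I" for t
    using derivatives_along_geodesic(3)[OF \<gamma> that] by (simp add: E[OF that] k[OF that])
  have f0: "component_\<xi> \<gamma> 0 \<le> 0" "?E * ?k < (component_\<xi> \<gamma> 0)\<^sup>2" and E0: "sgn ?E = \<eta>"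
    using v by (simp_all add: start[OF tangent_functions(1)] start[OF tangent_functions(2)] start[OF tangent_functions(3)])
  have "has_causal_type A g \<eta> I \<gamma>"
    unfolding has_causal_type_def
  proof (intro ballI impI conjI)
    fix t d assume t: "t \<in> I" and d: "d \<in> A" "\<gamma> t \<in> fst d"
    have y: "snd d (\<gamma> t) \<in> chart_image d" using d(2) by (rule chart_imageI)
    note eqs = on_velocity_eq[OF atlas _ g_at[OF t] d]
    show "sgn (g d (snd d (\<gamma> t)) (velocity d \<gamma> t) (velocity d \<gamma> t)) = \<eta>"
      using eqs[OF tangent_functions(1)] E[OF t] E0 by simp
    have "energy \<gamma> t * sq_norm_\<xi> \<gamma> t < (component_\<xi> \<gamma> t)\<^sup>2"
      using riccati_discriminant_pos[OF I(2) 0(1) t f f0(2)] by (simp add: E[OF t] k[OF t])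
    then show "velocity d \<gamma> t \<noteq> 0"
      by (auto simp: eqs[OF tangent_functions(1)] eqs[OF tangent_functions(3)] bil_simps[OF d(1) y])
  qed
  then have "I = UNIV" using complete max unfolding geodesically_complete_def by blast
  then show False using riccati_no_global_solution[of "component_\<xi> \<gamma>" "?E * ?k"] f f0 by simp
qed

end

theorem theorem3:
  fixes A :: "('m::{t2_space, second_countable_topology}, 'e::euclidean_space) chart set"
    and g :: "('m, 'e) form2"
    and Dg D :: "('m, 'e) christoffel"
    and \<xi> :: "('m, 'e) vector_field"
    and S :: "('m, 'e) form3"
  assumes "lorentzian_manifold A g"
    and "levi_civita A g Dg"
    and "twistor_free_connection A g Dg D \<xi> S"
    and "parallel_torsion A D"
    and "\<forall>c\<in>A. \<forall>x\<in>chart_image c. \<xi> c x \<noteq> 0"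
  shows "\<forall>\<eta>\<in>{1, -1, 0}. \<not> geodesically_complete A g Dg \<eta>"
proof -
  interpret twistor_free_parallel A g Dg D \<xi> S
    using assms(1-4) by unfold_locales
  show ?thesis using not_geodesically_complete[OF assms(5)] by blast
qed

end
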